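(* Let $\nu$ be a centered probability distribution on $\mathbb{R}$ with finite second moment. Let $\eta>0$ and $\xi\in\mathcal{R}^\eta(\nu)$. Then there exists a non-randomized stopping time $\bar\xi\in\mathcal{R}^\eta(\nu)$ such that $\bar\xi(G)=\xi(G)$ for all $G\in C_b^\eta$.
   Context: $C_0(\mathbb{R}_+)$ is the set of continuous $\omega:\mathbb{R}_+\to\mathbb{R}$ with $\omega_0=0$ (topology of locally uniform convergence), equipped with the Wiener measure $\mathbb{W}$. $B_t(\omega)=\omega_t$ is the coordinate process and $\mathbb{F}=(\mathcal{F}_t)_{t\ge0}$, $\mathcal{F}_t=\sigma(B_s,\,s\le t)$, is the raw canonical filtration. $\mathcal{T}$ is the set of a.s. finite $\mathbb{F}$-stopping times. A randomized stopping time is a probability measure $\xi$ on $C_0(\mathbb{R}_+)\times\mathbb{R}_+$ with disintegration $\xi(d\omega,dt)=\mathbb{W}(d\omega)\,\xi_\omega(dt)$ such that $\xi_\omega(\mathbb{R}_+)=1$ for almost all $\omega$ and $\omega\mapsto\xi_\omega([0,t])$ is $\mathcal{F}_t$-measurable for all $t\ge0$; the set of these is $\mathcal{R}$. With $\boldsymbol{t}(\omega,t)=t$ and $B(\omega,t)=\omega_t$, $\mathcal{R}(\nu)$ is the set of $\xi\in\mathcal{R}$ with $\int\boldsymbol{t}\,d\xi<\infty$ and $\xi\circ B^{-1}=\nu$. A randomized stopping time is non-randomized if it is of the form $\xi^\tau$ with kernel $\xi^\tau_\omega=\delta_{\tau(\omega)}$ for some $\tau\in\mathcal{T}$. $\xi(G):=\int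 G\,d\xi$. For $\eta>0$ let $\tau_\eta(\omega)=\inf\{t:\,|(t,\omega_t)|\ge\eta\}$, with $|\cdot|$ the Euclidean norm on $\mathbb{R}^2$. $\mathcal{R}^\eta$ is the set of $\xi\in\mathcal{R}$ with $\xi_\omega([\tau_\eta(\omega),\infty))=1$ for almost all $\omega$, and $\mathcal{R}^\eta(\nu)=\mathcal{R}^\eta\cap\mathcal{R}(\nu)$. $C_b^\eta$ is the set of bounded continuous $G:C_0(\mathbb{R}_+)\times\mathbb{R}_+\to\mathbb{R}$ such that whenever $\omega,\omega'\in C_0(\mathbb{R}_+)$ satisfy $\tau_\eta(\omega)=\tau_\eta(\omega')=:t_0$ and $\omega|_{[t_0,\infty)}=\omega'|_{[t_0,\infty)}$, then $G(\omega,t)=G(\omega',t)$ for all $t\ge0$. *)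

theory Defs
  imports "HOL-Probability.Probability"
begin

(* C_0(R_+): a path on [0,oo) is represented by its extension by 0 to the negative half-line,
   so that equality of paths is equality on [0,oo). *)
typedef c0path = "{w :: real \<Rightarrow> real. continuous_on {0..} w \<and> w 0 = 0 \<and> (\<forall>t<0. w t = 0)}"
  morphisms path_at Abs_c0path
  by (rule exI[of _ "\<lambda>_. 0"]) simp

instantiation c0path :: topological_space
begin

(* topology of locally uniform convergence *)
definition open_c0path :: "c0path set \<Rightarrow> bool" where
  "open_c0path U \<longleftrightarrow>
     (\<forall>w\<in>U. \<exists>T\<ge>0. \<exists>e>0. {w'. \<forall>t\<in>{0..T}. \<bar>path_at w' t - path_at w t\<bar> < e} \<subseteq> U)"

instance
proof
  show "open (UNIV :: c0path set)"
    unfolding open_c0path_def by (auto intro: exI[of _ "0::real"] exI[of _ "1::real"])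
next
  fix S U :: "c0path set"
  assume S: "open S" and U: "open U"
  show "open (S \<inter> U)"
    unfolding open_c0path_def
  proof
    fix w assume w: "w \<in> S \<inter> U"
    obtain T1 e1 where 1: "T1 \<ge> 0" "e1 > 0"
        "{w'. \<forall>t\<in>{0..T1}. \<bar>path_at w' t - path_at w t\<bar> < e1} \<subseteq> S"
      using S w unfolding open_c0path_def by blast
    obtain T2 e2 where 2: "T2 \<ge> 0" "e2 > 0"
        "{w'. \<forall>t\<in>{0..T2}. \<bar>path_at w' t - path_at w t\<bar> < e2} \<subseteq> U"
      using U w unfolding open_c0path_def by blast
    have "{w'. \<forall>t\<in>{0..max T1 T2}. \<bar>path_at w' t - path_at w t\<bar> < min e1 e2} \<subseteq> S \<inter> U"
      using 1(3) 2(3) by fastforce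
    moreover have "max T1 T2 \<ge> 0" "min e1 e2 > 0" using 1 2 by auto
    ultimately show "\<exists>T\<ge>0. \<exists>e>0.
        {w'. \<forall>t\<in>{0..T}. \<bar>path_at w' t - path_at w t\<bar> < e} \<subseteq> S \<inter> U"
      by blast
  qed
next
  fix K :: "c0path set set"
  assume K: "\<forall>S\<in>K. open S"
  show "open (\<Union>K)"
    unfolding open_c0path_def
  proof
    fix w assume "w \<in> \<Union>K"
    then obtain S where S: "S \<in> K" "w \<in> S" by blast
    then obtain T e where "T \<ge> 0" "e > 0"
        "{w'. \<forall>t\<in>{0..T}. \<bar>path_at w' t - path_at w t\<bar> < e} \<subseteq> S"
      using K unfolding open_c0path_def by blast
    with S show "\<exists>T\<ge>0. \<exists>e>0. {w'. \<forall>t\<in>{0..T}. \<bar>path_at w' t - path_at w t\<bar> < e} \<subseteq> \<Union>K"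
      by blast
  qed
qed

end

definition wiener_measure :: "c0path measure \<Rightarrow> bool" where
  "wiener_measure W \<longleftrightarrow>
     prob_space W \<and> sets W = sets borel \<and>
     (\<forall>s t. 0 \<le> s \<and> s < t \<longrightarrow>
        distributed W lborel (\<lambda>\<omega>. path_at \<omega> t - path_at \<omega> s) (normal_density 0 (sqrt (t - s)))) \<and>
     (\<forall>(n::nat) (t :: nat \<Rightarrow> real). 0 \<le> t 0 \<and> (\<forall>i<n. t i < t (Suc i)) \<longrightarrow>
        prob_space.indep_vars W (\<lambda>_. borel)
          (\<lambda>i \<omega>. path_at \<omega> (t (Suc i)) - path_at \<omega> (t i)) {..<n})"

(* F_t = sigma(B_s, s <= t), without completion or right-continuous regularization. The index set
   is [0,oo], because stopping times may be infinite on a null set; the index oo imposes no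
   condition on a stopping time. *)
definition raw_filtration :: "ennreal \<Rightarrow> c0path measure" where
  "raw_filtration t = sigma UNIV
     {(\<lambda>\<omega>. path_at \<omega> s) -` A | s A. 0 \<le> s \<and> ennreal s \<le> t \<and> A \<in> sets (borel :: real measure)}"

definition finite_stopping_times :: "c0path measure \<Rightarrow> (c0path \<Rightarrow> ennreal) set" where
  "finite_stopping_times W =
     {\<tau>. stopping_time raw_filtration \<tau> \<and> (AE \<omega> in W. \<tau> \<omega> < \<top>)}"

definition Rplus_borel :: "real measure" where
  "Rplus_borel = restrict_space borel {0..}"

(* xi(d omega, dt) = W(d omega) kappa_omega(dt). The kernel may lose mass on a W-null set. *)
definition disintegrates ::
    "c0path measure \<Rightarrow> (c0path \<times> real) measure \<Rightarrow> (c0path \<Rightarrow> real measure) \<Rightarrow> bool" where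
  "disintegrates W \<xi> \<kappa> \<longleftrightarrow>
     sets \<xi> = sets (borel \<Otimes>\<^sub>M Rplus_borel) \<and>
     \<kappa> \<in> W \<rightarrow>\<^sub>M subprob_algebra Rplus_borel \<and>
     (\<forall>A\<in>sets \<xi>. emeasure \<xi> A = (\<integral>\<^sup>+\<omega>. emeasure (\<kappa> \<omega>) (Pair \<omega> -` A) \<partial>W))"

definition rst_kernel ::
    "c0path measure \<Rightarrow> (c0path \<times> real) measure \<Rightarrow> (c0path \<Rightarrow> real measure) \<Rightarrow> bool" where
  "rst_kernel W \<xi> \<kappa> \<longleftrightarrow>
     disintegrates W \<xi> \<kappa> \<and>
     (AE \<omega> in W. emeasure (\<kappa> \<omega>) {0..} = 1) \<and>
     (\<forall>t\<ge>0. (\<lambda>\<omega>. emeasure (\<kappa> \<omega>) {0..t}) \<in> borel_measurable (raw_filtration (ennreal t)))"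

definition RST :: "c0path measure \<Rightarrow> (c0path \<times> real) measure set" where
  "RST W = {\<xi>. prob_space \<xi> \<and> (\<exists>\<kappa>. rst_kernel W \<xi> \<kappa>)}"

definition RST_embed :: "c0path measure \<Rightarrow> real measure \<Rightarrow> (c0path \<times> real) measure set" where
  "RST_embed W \<nu> =
     {\<xi>\<in>RST W. (\<integral>\<^sup>+(\<omega>, t). ennreal t \<partial>\<xi>) < \<infinity> \<and> distr \<xi> borel (\<lambda>(\<omega>, t). path_at \<omega> t) = \<nu>}"

(* The kernel of xi^tau; the Dirac mass at oo has no mass on R_+. *)
definition dirac_kernel :: "(c0path \<Rightarrow> ennreal) \<Rightarrow> c0path \<Rightarrow> real measure" where
  "dirac_kernel \<tau> \<omega> =
     (if \<tau> \<omega> < \<top> then return Rplus_borel (enn2real (\<tau> \<omega>)) else null_measure Rplus_borel)"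

definition nonrandomized :: "c0path measure \<Rightarrow> (c0path \<times> real) measure \<Rightarrow> bool" where
  "nonrandomized W \<xi> \<longleftrightarrow>
     \<xi> \<in> RST W \<and> (\<exists>\<tau>\<in>finite_stopping_times W. disintegrates W \<xi> (dirac_kernel \<tau>))"

(* The norm on real * real is the Euclidean one. The set contains eta, so the infimum is real. *)
definition tau_eta :: "real \<Rightarrow> c0path \<Rightarrow> real" where
  "tau_eta \<eta> \<omega> = Inf {t. 0 \<le> t \<and> norm (t, path_at \<omega> t) \<ge> \<eta>}"

definition RST_eta :: "c0path measure \<Rightarrow> real \<Rightarrow> (c0path \<times> real) measure set" where
  "RST_eta W \<eta> =
     {\<xi>\<in>RST W. \<exists>\<kappa>. rst_kernel W \<xi> \<kappa> \<and> (AE \<omega> in W. emeasure (\<kappa> \<omega>) {tau_eta \<eta> \<omega>..} = 1)}"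

definition RST_eta_embed ::
    "c0path measure \<Rightarrow> real \<Rightarrow> real measure \<Rightarrow> (c0path \<times> real) measure set" where
  "RST_eta_embed W \<eta> \<nu> = RST_eta W \<eta> \<inter> RST_embed W \<nu>"

(* Only the values of G on C_0(R_+) * R_+ matter. *)
definition Cb_eta :: "real \<Rightarrow> (c0path \<times> real \<Rightarrow> real) set" where
  "Cb_eta \<eta> =
     {G. continuous_on (UNIV \<times> {0..}) G \<and> bounded (G ` (UNIV \<times> {0..})) \<and>
         (\<forall>\<omega> \<omega>'. tau_eta \<eta> \<omega> = tau_eta \<eta> \<omega>' \<and>
             (\<forall>s\<ge>tau_eta \<eta> \<omega>. path_at \<omega> s = path_at \<omega>' s) \<longrightarrow>
             (\<forall>t\<ge>0. G (\<omega>, t) = G (\<omega>', t)))}"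

end

theory Submission
  imports Defs
begin

text \<open>The randomness needed to realize \<open>\<xi>\<close> by a genuine stopping time is read off the part of the
  path before \<open>\<tau>\<^sub>\<eta>\<close>, which the test functions do not see. If \<open>s < \<tau>\<^sub>\<eta>\<close>, one may add to the path a
  multiple of the tent function on \<open>[0,s]\<close> without changing the path after \<open>s\<close>; by the Cameron-Martin
  formula, the coefficient \<open>N = \<omega>\<^bsub>s/2\<^esub> - \<omega>\<^sub>s/2\<close> of the tent is normal and independent of the rest of
  the path. Those values of the coefficient for which \<open>s < \<tau>\<^sub>\<eta>\<close> persists form a set \<open>A\<close> that depends
  only on the rest of the path, and on \<open>{s < \<tau>\<^sub>\<eta>}\<close> the conditional law of \<open>N\<close> is the normal law
  restricted to \<open>A\<close>. One stops as soon as the average of \<open>\<xi>\<^sub>\<omega>([0,t])\<close> over the coefficients in \<open>A\<close>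
  exceeds the conditional distribution function of \<open>N\<close>, evaluated at \<open>N\<close>. The latter is conditionally
  uniform, so the joint law of the stopping time and of the path after \<open>\<tau>\<^sub>\<eta>\<close> is the same as under
  \<open>\<xi>\<close>. The level \<open>s\<close> is the largest \<open>\<eta>/2\<^sup>n\<close> below \<open>\<tau>\<^sub>\<eta>\<close>, which does not see the tent either.\<close>

subsection \<open>Path space and its Borel sets\<close>

text \<open>The filtration is raw, so the randomizing variable has to be a functional of the path
  itself: known at every time \<open>t\<close> at which stopping may be decided, and unrelated to
  all that \<open>G\<close> and the embedding condition see. No fixed \<open>s\<close> serves, since
  \<open>tau_eta\<close> is positive but not bounded away from 0. Conditioning on
  \<open>s < tau_eta\<close> disturbs the independence of the coefficient, because a large tent can
  push the path out of the ball before \<open>s\<close>; restricting the normal law to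
  \<open>alive\<close> accounts for this. On a given level, with the rest of the path fixed, an
  event of the path after the exit is either impossible or holds for all alive coefficients, so
  replacing the kernel by its average does not change integrals against such events. The average
  remains adapted because the tent lives on \<open>[0,s]\<close> with \<open>s < t\<close>. Finally,
  the event that stopping occurs by \<open>t\<close> must lie in \<open>raw_filtration t\<close>
  exactly, with no null sets added and no look to the right of \<open>t\<close>; this is where
  right-continuity of the averaged mass enters.\<close>

lemma path_at_zero [simp]: "path_at \<omega> 0 = 0"
  using path_at[of \<omega>] by simp

lemma path_at_neg: "t < 0 \<Longrightarrow> path_at \<omega> t = 0"
  using path_at[of \<omega>] by simp

lemma continuous_on_path_at: "continuous_on {0..} (path_at \<omega>)"
  using path_at[of \<omega>] by simp

lemma c0path_eqI: "(\<And>t. 0 \<le> t \<Longrightarrow> path_at \<omega> t = path_at \<omega>' t) \<Longrightarrow> \<omega> = \<omega>'"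
  by (metis ext path_at_inject path_at_neg not_le)

lemma space_raw_filtration [simp]: "space (raw_filtration t) = UNIV"
  unfolding raw_filtration_def by (simp add: space_measure_of_conv)

lemma sets_raw_filtration:
  "sets (raw_filtration t) = sigma_sets UNIV
     {(\<lambda>\<omega>. path_at \<omega> s) -` A | s A. 0 \<le> s \<and> ennreal s \<le> t \<and> A \<in> sets (borel :: real measure)}"
  unfolding raw_filtration_def by (simp add: sets_measure_of_conv)

lemma measurable_path_at_raw [measurable (raw)]:
  "ennreal s \<le> t \<Longrightarrow> (\<lambda>\<omega>. path_at \<omega> s) \<in> borel_measurable (raw_filtration t)"
proof (cases "0 \<le> s")
  case True
  assume "ennreal s \<le> t"
  with True show ?thesis
    by (intro measurableI) (auto simp: sets_raw_filtration intro!: sigma_sets.Basic)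
next
  case False
  \<comment> \<open>For negative \<open>s\<close> the hypothesis is void, as
    \<open>ennreal s\<close> is 0, but the coordinate is then constantly 0.\<close>
  then show ?thesis by (simp add: path_at_neg)
qed

lemma measurable_into_raw:
  assumes "f \<in> space M \<rightarrow> UNIV"
  assumes "\<And>s. 0 \<le> s \<Longrightarrow> ennreal s \<le> t \<Longrightarrow> (\<lambda>x. path_at (f x) s) \<in> borel_measurable M"
  shows "f \<in> measurable M (raw_filtration t)"
  unfolding raw_filtration_def
proof (rule measurable_measure_of)
  fix y assume "y \<in> {(\<lambda>\<omega>. path_at \<omega> s) -` A | s A. 0 \<le> s \<and> ennreal s \<le> t \<and> A \<in> sets (borel :: real measure)}"
  then obtain s A where y: "y = (\<lambda>\<omega>. path_at \<omega> s) -` A" "0 \<le> s" "ennreal s \<le> t" "A \<in> sets borel"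
    by blast
  have "(\<lambda>x. path_at (f x) s) -` A \<inter> space M \<in> sets M"
    using assms(2)[OF y(2,3)] y(4) by (rule measurable_sets)
  then show "f -` y \<inter> space M \<in> sets M"
    unfolding y by (simp add: vimage_def)
qed auto

lemma raw_filtration_mono: "s \<le> t \<Longrightarrow> sets (raw_filtration s) \<subseteq> sets (raw_filtration t)"
  unfolding sets_raw_filtration by (rule sigma_sets_mono') (auto intro: order.trans)

lemma continuous_path_at: "continuous_on UNIV (\<lambda>\<omega>. path_at \<omega> s)"
proof (cases "0 \<le> s")
  case True
  have "open ((\<lambda>\<omega>. path_at \<omega> s) -` B)" if B: "open B" for B
    unfolding open_c0path_def
  proof
    fix w assume "w \<in> (\<lambda>\<omega>. path_at \<omega> s) -` B"
    then obtain e where "e > 0" "ball (path_at w s) e \<subseteq> B"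
      using B open_contains_ball by blast
    then have "{w'. \<forall>t\<in>{0..s}. \<bar>path_at w' t - path_at w t\<bar> < e} \<subseteq> (\<lambda>\<omega>. path_at \<omega> s) -` B"
      using True by (auto simp: subset_eq dist_real_def abs_minus_commute)
    with True \<open>e > 0\<close> show "\<exists>T\<ge>0. \<exists>e>0. {w'. \<forall>t\<in>{0..T}. \<bar>path_at w' t - path_at w t\<bar> < e}
        \<subseteq> (\<lambda>\<omega>. path_at \<omega> s) -` B"
      by blast
  qed
  then show ?thesis by (simp add: continuous_on_open_vimage)
qed (simp add: path_at_neg)

lemma measurable_path_at [measurable]: "(\<lambda>\<omega>. path_at \<omega> s) \<in> borel_measurable borel"
  by (rule borel_measurable_continuous_onI[OF continuous_path_at])

lemma raw_filtration_le_borel: "sets (raw_filtration t) \<subseteq> sets borel"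
  unfolding sets_raw_filtration
  by (rule sets.sigma_sets_subset[where M=borel, simplified])
     (auto intro!: measurable_sets_borel)

lemma pred_countable_Ball:
  assumes "countable X" "\<And>i. i \<in> X \<Longrightarrow> Measurable.pred M (\<lambda>x. P x i)"
  shows "Measurable.pred M (\<lambda>x. \<forall>i\<in>X. P x i)"
proof -
  have "(\<Union>i\<in>X. {x\<in>space M. \<not> P x i}) \<in> sets M"
    using assms by (intro sets.countable_UN'') (auto simp: pred_def)
  then have "space M - (\<Union>i\<in>X. {x\<in>space M. \<not> P x i}) \<in> sets M" by auto
  also have "space M - (\<Union>i\<in>X. {x\<in>space M. \<not> P x i}) = {x\<in>space M. \<forall>i\<in>X. P x i}" by auto
  finally show ?thesis by (simp add: pred_def)
qed

text \<open>Brings bounds over an uncountable time interval down to countably many times. Positivity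
  of \<open>T\<close> keeps the clipped neighbourhood of \<open>t\<close> a nonempty open interval
  even when \<open>t\<close> is an endpoint.\<close>

lemma le_of_rational:
  fixes f :: "real \<Rightarrow> real"
  assumes f: "continuous_on {0..T} f" "0 < T"
    and le: "\<And>q. q \<in> \<rat> \<Longrightarrow> 0 \<le> q \<Longrightarrow> q \<le> T \<Longrightarrow> f q \<le> c" and t: "0 \<le> t" "t \<le> T"
  shows "f t \<le> c"
proof (rule ccontr)
  assume "\<not> f t \<le> c"
  then have "f t - c > 0" by simp
  then obtain d where d: "d > 0" "\<And>u. u \<in> {0..T} \<Longrightarrow> dist u t < d \<Longrightarrow> dist (f u) (f t) < f t - c"
    using f(1) t unfolding continuous_on_iff by (metis atLeastAtMost_iff)
  have "max 0 (t - d) < min T (t + d)" using d(1) t f(2) by auto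
  then obtain q where q: "q \<in> \<rat>" "max 0 (t - d) < q" "q < min T (t + d)"
    using Rats_dense_in_real by blast
  then have "dist (f q) (f t) < f t - c" by (intro d(2)) (auto simp: dist_real_def)
  with le[of q] q show False by (auto simp: dist_real_def)
qed

text \<open>Every open set is a countable union of cylinder sets: neighbourhoods are given by step
  functions with rational values on a uniform grid, compared with the path at rational times only.\<close>
lemma borel_eq_raw_top: "sets (borel :: c0path measure) = sets (raw_filtration \<top>)"
proof
  show "sets (raw_filtration \<top>) \<subseteq> sets (borel :: c0path measure)"
    by (rule raw_filtration_le_borel)
  define c where "c n xs t = real_of_int (xs ! nat \<lfloor>real n * t\<rfloor>) / real n" for n :: nat and xs t
  define S where "S m n T xs = {w. \<forall>q\<in>\<rat> \<inter> {0..real T}. \<bar>path_at w q - c n xs q\<bar> \<le> 2 / real m}"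
    for m n T :: nat and xs
  have S_meas: "S m n T xs \<in> sets (raw_filtration \<top>)" for m n T xs
  proof -
    have "Measurable.pred (raw_filtration \<top>) (\<lambda>w. \<forall>q\<in>\<rat> \<inter> {0..real T}. \<bar>path_at w q - c n xs q\<bar> \<le> 2 / real m)"
      by (intro pred_countable_Ball) (auto intro!: countable_rat countable_Int1 measurable_path_at_raw)
    then show ?thesis by (simp add: pred_def S_def)
  qed
  show "sets (borel :: c0path measure) \<subseteq> sets (raw_filtration \<top>)"
    unfolding borel_def
  proof (simp add: sets_measure_of_conv, rule sets.sigma_sets_subset[where M="raw_filtration \<top>", simplified], safe)
    fix U :: "c0path set" assume U: "open U"
    \<comment> \<open>The indices are three naturals and an integer list, so any such
      \<open>I\<close> is countable.\<close>
    define I where "I = {(m, n, T, xs). S m n T xs \<subseteq> U}"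
    have "w \<in> (\<Union>(m, n, T, xs)\<in>I. S m n T xs)" if "w \<in> U" for w
    proof -
      obtain T0 e where T0: "T0 \<ge> 0" "e > 0" "{w'. \<forall>t\<in>{0..T0}. \<bar>path_at w' t - path_at w t\<bar> < e} \<subseteq> U"
        using U \<open>w \<in> U\<close> unfolding open_c0path_def by blast
      define T where "T = Suc (nat \<lceil>T0\<rceil>)"
      have T: "T0 \<le> real T" "0 < real T" unfolding T_def by linarith+
      \<comment> \<open>Two paths in the same \<open>S m n T xs\<close> are each within
        \<open>2 / m\<close> of the step function at rational times, hence within
        \<open>4 / m\<close> of each other.\<close>
      obtain m where m: "0 < m" "1 / real m < e / 4"
        using T0(2) by (metis divide_pos_pos nat_approx_posE zero_less_Suc zero_less_numeral)
      have "uniformly_continuous_on {0..real T} (path_at w)"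
        by (rule compact_uniformly_continuous) (auto intro: continuous_on_subset[OF continuous_on_path_at])
      then obtain d where d: "d > 0" "\<And>t u. t \<in> {0..real T} \<Longrightarrow> u \<in> {0..real T} \<Longrightarrow> dist u t < d \<Longrightarrow>
          dist (path_at w u) (path_at w t) < 1 / m"
        unfolding uniformly_continuous_on_def using m(1) by (metis of_nat_0_less_iff zero_less_divide_1_iff)
      obtain n' where n': "0 < n'" "1 / real n' < d"
        using d(1) by (metis nat_approx_posE zero_less_Suc)
      \<comment> \<open>The mesh \<open>1 / n\<close> has to be below the modulus of continuity
        \<open>d\<close>, and rounding values to multiples of \<open>1 / n\<close> may cost at most
        \<open>1 / m\<close>.\<close>
      define n where "n = max n' m"
      have n: "0 < n" "1 / real n < d" "1 / real n \<le> 1 / real m"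
        using n' m(1) unfolding n_def by (auto simp: frac_le intro: le_less_trans[OF _ n'(2)])
      define xs where "xs = map (\<lambda>k. \<lfloor>real n * path_at w (real k / real n)\<rfloor>) [0..<Suc (n * T)]"
      have "\<bar>path_at w q - c n xs q\<bar> \<le> 2 / real m" if q: "0 \<le> q" "q \<le> real T" for q
      proof -
        define k where "k = nat \<lfloor>real n * q\<rfloor>"
        have k: "real k \<le> real n * q" "real n * q < real k + 1"
          using q n(1) unfolding k_def by (auto simp: of_nat_nat)
        have "real k \<le> real n * real T" using k(1) q(2) n(1) by (smt (verit) mult_left_mono of_nat_0_le_iff)
        then have "k < Suc (n * T)" by (metis le_imp_less_Suc of_nat_le_iff of_nat_mult)
        then have c: "c n xs q = \<lfloor>real n * path_at w (real k / real n)\<rfloor> / real n"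
          unfolding c_def xs_def k_def[symmetric] by (simp del: upt_Suc)
        have kn: "real k / real n \<le> q" "q < real k / real n + 1 / real n"
          using k n(1) by (auto simp: field_simps)
        have "dist (path_at w q) (path_at w (real k / real n)) < 1 / m"
          using kn q n by (intro d(2)) (auto simp: dist_real_def)
        moreover have "\<bar>path_at w (real k / real n) - c n xs q\<bar> \<le> 1 / real n"
        proof -
          let ?y = "path_at w (real k / real n)"
          have "\<bar>real n * ?y - \<lfloor>real n * ?y\<rfloor>\<bar> \<le> 1" by linarith
          then have "\<bar>real n * ?y - \<lfloor>real n * ?y\<rfloor>\<bar> / real n \<le> 1 / real n"
            by (intro divide_right_mono) auto
          moreover have "?y - c n xs q = (real n * ?y - \<lfloor>real n * ?y\<rfloor>) / real n"
            unfolding c using n(1) by (simp add: field_simps)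
          ultimately show ?thesis by (simp add: abs_divide)
        qed
        ultimately show ?thesis using n(3) by (simp add: dist_real_def)
      qed
      then have w: "w \<in> S m n T xs" unfolding S_def by auto
      have "S m n T xs \<subseteq> U"
      proof
        fix w' assume "w' \<in> S m n T xs"
        then have *: "\<bar>path_at v q - c n xs q\<bar> \<le> 2 / real m" if "v \<in> {w, w'}" "q \<in> \<rat>" "0 \<le> q" "q \<le> real T" for v q
          using w that unfolding S_def by auto
        have rat: "\<bar>path_at w' q - path_at w q\<bar> \<le> 4 / real m" if "q \<in> \<rat>" "0 \<le> q" "q \<le> real T" for q
          using *[of w q] *[of w' q] that by simp
        have cont: "continuous_on {0..real T} (\<lambda>t. \<bar>path_at w' t - path_at w t\<bar>)"
          by (intro continuous_intros continuous_on_subset[OF continuous_on_path_at]) auto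
        have **: "\<bar>path_at w' t - path_at w t\<bar> \<le> 4 / real m" if "0 \<le> t" "t \<le> real T" for t
          by (rule le_of_rational[OF cont T(2) rat that])
        have "\<bar>path_at w' t - path_at w t\<bar> < e" if "t \<in> {0..T0}" for t
          using **[of t] that T(1) m(2) by simp
        then show "w' \<in> U" using T0(3) by blast
      qed
      with w show ?thesis unfolding I_def by blast
    qed
    then have "U = (\<Union>(m, n, T, xs)\<in>I. S m n T xs)"
      by (auto simp: I_def)
    moreover have "(\<Union>(m, n, T, xs)\<in>I. S m n T xs) \<in> sets (raw_filtration \<top>)"
      by (intro sets.countable_UN'') (auto simp: S_meas)
    ultimately show "U \<in> sets (raw_filtration \<top>)" by simp
  qed
qed

lemma measurable_into_borel_c0path:
  assumes "\<And>s. 0 \<le> s \<Longrightarrow> (\<lambda>x. path_at (f x) s) \<in> borel_measurable M"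
  shows "f \<in> borel_measurable M"
  using measurable_into_raw[of f M \<top>] assms measurable_cong_sets[OF refl borel_eq_raw_top] by blast

subsection \<open>The exit time and the information after it\<close>

text \<open>The set under the infimum is closed by continuity of the path, and it contains
  \<open>\<eta>\<close> because the time component alone reaches that size; so the infimum is
  attained.\<close>

lemma tau_eta_mem:
  assumes "0 < \<eta>"
  shows "0 \<le> tau_eta \<eta> \<omega>" "\<eta> \<le> norm (tau_eta \<eta> \<omega>, path_at \<omega> (tau_eta \<eta> \<omega>))"
    and tau_eta_le: "\<And>t. 0 \<le> t \<Longrightarrow> \<eta> \<le> norm (t, path_at \<omega> t) \<Longrightarrow> tau_eta \<eta> \<omega> \<le> t"
proof -
  let ?X = "{t. 0 \<le> t \<and> norm (t, path_at \<omega> t) \<ge> \<eta>}"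
  have "norm (\<eta>, path_at \<omega> \<eta>) \<ge> norm \<eta>"
    by (metis norm_fst_le fst_conv)
  then have "\<eta> \<in> ?X" using assms by auto
  have bdd: "bdd_below ?X" by (rule bdd_belowI[of _ 0]) auto
  have "continuous_on {0..} (\<lambda>t. norm (t, path_at \<omega> t))"
    by (intro continuous_intros continuous_on_path_at)
  then have "closed ({0..} \<inter> (\<lambda>t. norm (t, path_at \<omega> t)) -` {\<eta>..})"
    by (rule continuous_closed_preimage) auto
  also have "{0..} \<inter> (\<lambda>t. norm (t, path_at \<omega> t)) -` {\<eta>..} = ?X" by auto
  finally have "Inf ?X \<in> ?X"
    using closed_contains_Inf[of ?X] bdd \<open>\<eta> \<in> ?X\<close> by blast
  then show "0 \<le> tau_eta \<eta> \<omega>" "\<eta> \<le> norm (tau_eta \<eta> \<omega>, path_at \<omega> (tau_eta \<eta> \<omega>))"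
    unfolding tau_eta_def by auto
  show "\<And>t. 0 \<le> t \<Longrightarrow> \<eta> \<le> norm (t, path_at \<omega> t) \<Longrightarrow> tau_eta \<eta> \<omega> \<le> t"
    unfolding tau_eta_def using bdd by (auto intro: cInf_lower)
qed

text \<open>Attainment of the infimum turns a strict comparison with the exit time into a condition
  on the path up to \<open>s\<close> only, which is what adaptedness to the raw filtration
  requires.\<close>

lemma tau_eta_gt_iff:
  assumes "0 < \<eta>" "0 \<le> s"
  shows "s < tau_eta \<eta> \<omega> \<longleftrightarrow> (\<forall>u\<in>{0..s}. norm (u, path_at \<omega> u) < \<eta>)"
proof
  assume s: "s < tau_eta \<eta> \<omega>"
  show "\<forall>u\<in>{0..s}. norm (u, path_at \<omega> u) < \<eta>"
  proof
    fix u assume "u \<in> {0..s}"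
    then show "norm (u, path_at \<omega> u) < \<eta>"
      using tau_eta_le[OF assms(1), of u \<omega>] s by (cases "\<eta> \<le> norm (u, path_at \<omega> u)") auto
  qed
next
  assume "\<forall>u\<in>{0..s}. norm (u, path_at \<omega> u) < \<eta>"
  then show "s < tau_eta \<eta> \<omega>"
    using tau_eta_mem(1,2)[OF assms(1), of \<omega>] by (cases "tau_eta \<eta> \<omega> \<le> s") (auto simp: not_le[symmetric])
qed

lemma tau_eta_pos: "0 < \<eta> \<Longrightarrow> 0 < tau_eta \<eta> \<omega>"
  by (subst tau_eta_gt_iff) auto

text \<open>Up to \<open>s\<close> neither path has left the ball and from \<open>s\<close> on they
  coincide, so both exit times compare alike with every \<open>r \<ge> s\<close>; the smaller of two
  distinct exit times would be such an \<open>r\<close>.\<close>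

lemma tau_eta_eqI:
  assumes "0 < \<eta>" "0 \<le> s" "s < tau_eta \<eta> \<omega>" "s < tau_eta \<eta> \<omega>'"
    and "\<And>u. s \<le> u \<Longrightarrow> path_at \<omega> u = path_at \<omega>' u"
  shows "tau_eta \<eta> \<omega> = tau_eta \<eta> \<omega>'"
proof -
  have "r < tau_eta \<eta> \<omega> \<longleftrightarrow> r < tau_eta \<eta> \<omega>'" if "s \<le> r" for r
  proof -
    have "(\<forall>u\<in>{0..r}. norm (u, path_at \<omega> u) < \<eta>) \<longleftrightarrow> (\<forall>u\<in>{0..r}. norm (u, path_at \<omega>' u) < \<eta>)"
      using assms(3-5) unfolding tau_eta_gt_iff[OF assms(1,2)]
      by (metis atLeastAtMost_iff linorder_linear)
    then show ?thesis using assms(1,2) that by (simp add: tau_eta_gt_iff)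
  qed
  then show ?thesis using assms(3,4) by (metis less_le_not_le linorder_less_linear order_less_imp_le)
qed

text \<open>A strict bound at rational times alone would not give a strict bound at all times. The
  maximum over \<open>[0,s]\<close> is attained, so there is a uniform margin
  \<open>1 / (k + 1)\<close>, and non-strict bounds do pass from rational times to all
  times.\<close>

lemma pred_tau_eta_gt:
  assumes "0 < \<eta>" "0 \<le> s"
  shows "Measurable.pred (raw_filtration (ennreal s)) (\<lambda>\<omega>. s < tau_eta \<eta> \<omega>)"
\<comment> \<open>\<open>le_of_rational\<close> asks for a nondegenerate interval; at 0 the event is
  everything.\<close>
proof (cases "s = 0")
  case True
  then show ?thesis using tau_eta_pos[OF assms(1)] by simp
next
  case False
  have "(\<lambda>\<omega>. s < tau_eta \<eta> \<omega>) =
      (\<lambda>\<omega>. \<exists>k. \<forall>q\<in>\<rat> \<inter> {0..s}. norm (q, path_at \<omega> q) \<le> \<eta> - 1 / real (Suc k))"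
  proof
    fix \<omega>
    have cont: "continuous_on {0..s} (\<lambda>t. norm (t, path_at \<omega> t))"
      by (intro continuous_intros continuous_on_subset[OF continuous_on_path_at]) auto
    show "s < tau_eta \<eta> \<omega> \<longleftrightarrow> (\<exists>k. \<forall>q\<in>\<rat> \<inter> {0..s}. norm (q, path_at \<omega> q) \<le> \<eta> - 1 / real (Suc k))"
    proof
      assume "s < tau_eta \<eta> \<omega>"
      then have lt: "\<forall>u\<in>{0..s}. norm (u, path_at \<omega> u) < \<eta>"
        using assms by (simp add: tau_eta_gt_iff)
      obtain v where v: "v \<in> {0..s}" "\<forall>u\<in>{0..s}. norm (u, path_at \<omega> u) \<le> norm (v, path_at \<omega> v)"
        using continuous_attains_sup[OF _ _ cont] assms(2) by auto
      then have "0 < \<eta> - norm (v, path_at \<omega> v)" using lt by auto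
      then obtain k where "1 / real (Suc k) < \<eta> - norm (v, path_at \<omega> v)"
        by (rule nat_approx_posE)
      with v show "\<exists>k. \<forall>q\<in>\<rat> \<inter> {0..s}. norm (q, path_at \<omega> q) \<le> \<eta> - 1 / real (Suc k)"
        by (intro exI[of _ k]) fastforce
    next
      assume "\<exists>k. \<forall>q\<in>\<rat> \<inter> {0..s}. norm (q, path_at \<omega> q) \<le> \<eta> - 1 / real (Suc k)"
      then obtain k where "\<forall>q\<in>\<rat> \<inter> {0..s}. norm (q, path_at \<omega> q) \<le> \<eta> - 1 / real (Suc k)" ..
      then have k: "norm (q, path_at \<omega> q) \<le> \<eta> - 1 / real (Suc k)" if "q \<in> \<rat>" "0 \<le> q" "q \<le> s" for q
        using that by auto
      have "0 < s" using False assms by auto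
      have le: "norm (u, path_at \<omega> u) \<le> \<eta> - 1 / real (Suc k)" if "0 \<le> u" "u \<le> s" for u
        by (rule le_of_rational[OF cont \<open>0 < s\<close> k that])
      have "0 < 1 / real (Suc k)" by simp
      then have "norm (u, path_at \<omega> u) < \<eta>" if "0 \<le> u" "u \<le> s" for u
        using le[OF that] by linarith
      then show "s < tau_eta \<eta> \<omega>" using assms by (simp add: tau_eta_gt_iff)
    qed
  qed
  moreover have "Measurable.pred (raw_filtration (ennreal s)) (\<lambda>\<omega>. norm (q, path_at \<omega> q) \<le> c)"
    if "q \<in> \<rat> \<inter> {0..s}" for q c
  proof -
    have [measurable]: "(\<lambda>\<omega>. path_at \<omega> q) \<in> borel_measurable (raw_filtration (ennreal s))"
      using that by (intro measurable_path_at_raw) (auto intro: ennreal_leI)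
    show ?thesis unfolding norm_Pair by measurable
  qed
  ultimately show ?thesis
    by (simp only:) (intro pred_intros_countable pred_countable_Ball, auto intro!: countable_Int1 countable_rat)
qed

lemma measurable_raw_mono:
  "s \<le> t \<Longrightarrow> f \<in> measurable (raw_filtration s) N \<Longrightarrow> f \<in> measurable (raw_filtration t) N"
  using raw_filtration_mono[of s t] by (auto simp: measurable_def)

lemma measurable_raw_borel:
  "f \<in> measurable (raw_filtration t) N \<Longrightarrow> f \<in> measurable borel N"
  using raw_filtration_le_borel[of t] by (auto simp: measurable_def)

lemma pred_tau_eta_le:
  assumes "0 < \<eta>" "0 \<le> s" "s \<le> t"
  shows "Measurable.pred (raw_filtration (ennreal t)) (\<lambda>\<omega>. tau_eta \<eta> \<omega> \<le> s)"
    "Measurable.pred (raw_filtration (ennreal t)) (\<lambda>\<omega>. s < tau_eta \<eta> \<omega>)"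
proof -
  show *: "Measurable.pred (raw_filtration (ennreal t)) (\<lambda>\<omega>. s < tau_eta \<eta> \<omega>)"
    by (rule measurable_raw_mono[OF _ pred_tau_eta_gt]) (use assms in \<open>auto intro: ennreal_leI\<close>)
  have "Measurable.pred (raw_filtration (ennreal t)) (\<lambda>\<omega>. \<not> s < tau_eta \<eta> \<omega>)"
    using * by measurable
  then show "Measurable.pred (raw_filtration (ennreal t)) (\<lambda>\<omega>. tau_eta \<eta> \<omega> \<le> s)"
    by (simp add: not_less)
qed

lemma measurable_tau_eta: 
  assumes "0 < \<eta>"
  shows "tau_eta \<eta> \<in> borel_measurable borel"
proof (rule borel_measurableI_le)
  fix s
  show "{x \<in> space borel. tau_eta \<eta> x \<le> s} \<in> sets borel"
  proof (cases "0 \<le> s")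
    case True
    have "Measurable.pred borel (\<lambda>\<omega>. tau_eta \<eta> \<omega> \<le> s)"
      by (rule measurable_raw_borel[OF pred_tau_eta_le(1)[OF assms True order.refl]])
    then show ?thesis by (simp add: pred_def)
  next
    case False
    then have "{x \<in> space borel. tau_eta \<eta> x \<le> s} = {}"
      using tau_eta_mem(1)[OF assms] by (fastforce simp: not_le intro: order.trans)
    then show ?thesis by simp
  qed
qed

text \<open>Joint measurability from sections: time is rounded to a grid point on its right, so the
  approximants depend on time through countably many values. Right limits suffice, which admits
  functions that jump at \<open>tau_eta\<close>.\<close>

lemma measurable_pair_right_continuous:
  fixes G :: "'a \<times> real \<Rightarrow> 'b::metric_space"
  assumes meas: "\<And>t. 0 \<le> t \<Longrightarrow> (\<lambda>\<omega>. G (\<omega>, t)) \<in> borel_measurable M"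
    and cont: "\<And>\<omega> t. \<omega> \<in> space M \<Longrightarrow> 0 \<le> t \<Longrightarrow> ((\<lambda>u. G (\<omega>, u)) \<longlongrightarrow> G (\<omega>, t)) (at_right t)"
  shows "G \<in> borel_measurable (M \<Otimes>\<^sub>M Rplus_borel)"
proof (rule borel_measurable_LIMSEQ_metric)
  \<comment> \<open>The added 1 puts the grid point strictly to the right of \<open>t\<close>, so
    the limit is taken along \<open>at_right t\<close>.\<close>
  define a where "a n t = real (nat \<lfloor>real (Suc n) * t\<rfloor> + 1) / real (Suc n)" for n :: nat and t
  let ?f = "\<lambda>n p. G (fst p, a n (snd p))"
  have [measurable]: "snd \<in> borel_measurable (M \<Otimes>\<^sub>M Rplus_borel)"
    by (rule measurable_compose[OF measurable_snd]) (simp add: Rplus_borel_def measurable_restrict_space1)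
  show "?f n \<in> borel_measurable (M \<Otimes>\<^sub>M Rplus_borel)" for n
    unfolding a_def
  proof (rule measurable_compose_countable[where g="\<lambda>p. nat \<lfloor>real (Suc n) * snd p\<rfloor>"])
    show "(\<lambda>p. G (fst p, real (i + 1) / real (Suc n))) \<in> borel_measurable (M \<Otimes>\<^sub>M Rplus_borel)" for i
      by (rule measurable_compose[OF measurable_fst meas]) simp
  qed measurable
  fix p assume "p \<in> space (M \<Otimes>\<^sub>M Rplus_borel)"
  then obtain \<omega> t where p: "p = (\<omega>, t)" "\<omega> \<in> space M" "0 \<le> t"
    by (auto simp: space_pair_measure Rplus_borel_def space_restrict_space)
  have a: "t < a n t" "a n t \<le> t + 1 / real (Suc n)" for n
  proof -
    have 1: "real (nat \<lfloor>real (Suc n) * t\<rfloor>) \<le> real (Suc n) * t" "real (Suc n) * t < real (nat \<lfloor>real (Suc n) * t\<rfloor>) + 1"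
      using p(3) by (simp_all only: of_nat_nat zero_le_floor of_nat_0_le_iff mult_nonneg_nonneg of_int_floor_le) linarith+
    show "t < a n t" using 1 unfolding a_def by (simp add: field_simps del: of_nat_Suc)
    show "a n t \<le> t + 1 / real (Suc n)" using 1 unfolding a_def by (simp add: field_simps del: of_nat_Suc)
  qed
  have "(\<lambda>n. t + 1 / real (Suc n)) \<longlonglongrightarrow> t + 0"
    by (intro tendsto_intros LIMSEQ_Suc[OF lim_1_over_n])
  then have "(\<lambda>n. a n t) \<longlonglongrightarrow> t"
    by (intro tendsto_sandwich[of "\<lambda>_. t" "\<lambda>n. a n t" sequentially "\<lambda>n. t + 1 / real (Suc n)"])
       (simp_all add: a less_imp_le del: of_nat_Suc)
  then have "filterlim (\<lambda>n. a n t) (at_right t) sequentially"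
    using a(1) by (auto simp: filterlim_at less_imp_neq[symmetric] intro!: always_eventually)
  from filterlim_compose[OF cont[OF p(2,3)] this]
  show "(\<lambda>n. ?f n p) \<longlonglongrightarrow> G p" by (simp add: p)
qed

section \<open>The information carried by the path after the exit time\<close>

definition post_equiv :: "real \<Rightarrow> c0path \<Rightarrow> c0path \<Rightarrow> bool" where
  "post_equiv \<eta> \<omega> \<omega>' \<longleftrightarrow>
     tau_eta \<eta> \<omega> = tau_eta \<eta> \<omega>' \<and> (\<forall>s\<ge>tau_eta \<eta> \<omega>. path_at \<omega> s = path_at \<omega>' s)"

text \<open>Given by saturated Borel sets under the invariance relation of \<open>Cb_eta\<close>,
  not by generators: a Borel function constant on the classes is then measurable at once, without
  any factorization argument.\<close>

definition post_algebra :: "real \<Rightarrow> c0path measure" where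
  "post_algebra \<eta> = sigma UNIV {C \<in> sets borel. \<forall>\<omega> \<omega>'. post_equiv \<eta> \<omega> \<omega>' \<longrightarrow> (\<omega> \<in> C \<longleftrightarrow> \<omega>' \<in> C)}"

lemma space_post_algebra [simp]: "space (post_algebra \<eta>) = UNIV"
  by (simp add: post_algebra_def space_measure_of_conv)

lemma sets_post_algebra:
  "sets (post_algebra \<eta>) = {C \<in> sets borel. \<forall>\<omega> \<omega>'. post_equiv \<eta> \<omega> \<omega>' \<longrightarrow> (\<omega> \<in> C \<longleftrightarrow> \<omega>' \<in> C)}"
    (is "_ = ?S")
proof -
  have "sigma_algebra UNIV ?S"
    unfolding sigma_algebra_iff2
  proof (intro conjI ballI allI impI)
    fix A :: "nat \<Rightarrow> c0path set" assume A: "range A \<subseteq> ?S"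
    then have "(\<Union>i. A i) \<in> sets borel" by (intro sets.countable_UN) auto
    moreover have "\<omega> \<in> (\<Union>i. A i) \<longleftrightarrow> \<omega>' \<in> (\<Union>i. A i)" if "post_equiv \<eta> \<omega> \<omega>'" for \<omega> \<omega>'
      using A that by (simp add: image_subset_iff)
    ultimately show "(\<Union>i. A i) \<in> ?S" by simp
  qed auto
  then show ?thesis
    unfolding post_algebra_def by (rule sigma_algebra.sets_measure_of_eq)
qed

lemma measurable_post_algebraI:
  assumes "f \<in> measurable borel N" "\<And>\<omega> \<omega>'. post_equiv \<eta> \<omega> \<omega>' \<Longrightarrow> f \<omega> = f \<omega>'"
  shows "f \<in> measurable (post_algebra \<eta>) N"
proof (rule measurableI)
  show "f x \<in> space N" for x using measurable_space[OF assms(1)] by simp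
  fix A assume "A \<in> sets N"
  then have "f -` A \<in> sets borel" using measurable_sets[OF assms(1)] by force
  then show "f -` A \<inter> space (post_algebra \<eta>) \<in> sets (post_algebra \<eta>)"
    using assms(2) by (simp add: sets_post_algebra)
qed

subsection \<open>The Cameron-Martin formula\<close>

definition translate :: "c0path \<Rightarrow> real \<Rightarrow> c0path \<Rightarrow> c0path" where
  "translate h c \<omega> = Abs_c0path (\<lambda>t. path_at \<omega> t + c * path_at h t)"

lemma path_at_translate [simp]: "path_at (translate h c \<omega>) t = path_at \<omega> t + c * path_at h t"
  unfolding translate_def
  by (subst Abs_c0path_inverse) (auto intro!: continuous_intros continuous_on_path_at simp: path_at_neg)

text \<open>The Cameron-Martin path whose derivative is the indicator of \<open>[0,a]\<close>; its
  density therefore involves the path only through its value at \<open>a\<close>.\<close>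

definition ramp :: "real \<Rightarrow> c0path" where
  "ramp a = Abs_c0path (\<lambda>t. max 0 (min t a))"

lemma path_at_ramp [simp]: "0 \<le> a \<Longrightarrow> path_at (ramp a) t = max 0 (min t a)"
  unfolding ramp_def by (subst Abs_c0path_inverse) (auto intro!: continuous_intros)

lemma measurable_translate [measurable]: "translate h c \<in> measurable borel borel"
  by (rule measurable_into_borel_c0path) simp

text \<open>Finite-dimensional cylinders are an intersection-stable generator. The set
  \<open>F\<close> lets a proof assume that prescribed times are on the grid: adding a time with the
  trivial condition \<open>UNIV\<close> does not change a cylinder.\<close>

lemma measure_eqI_cylinder:
  fixes M N :: "c0path measure"
  assumes "finite_measure M" and [simp]: "sets M = sets borel" "sets N = sets borel"
    and "finite F" "F \<subseteq> {0..}"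
    and eq: "\<And>T A. finite T \<Longrightarrow> F \<subseteq> T \<Longrightarrow> T \<subseteq> {0..} \<Longrightarrow> (\<And>t. A t \<in> sets borel) \<Longrightarrow>
      emeasure M {\<omega>. \<forall>t\<in>T. path_at \<omega> t \<in> A t} = emeasure N {\<omega>. \<forall>t\<in>T. path_at \<omega> t \<in> A t}"
  shows "M = N"
proof (rule measure_eqI_generator_eq)
  let ?E = "{{\<omega>. \<forall>t\<in>T. path_at \<omega> t \<in> A t} | T A. finite T \<and> T \<subseteq> {0..} \<and> (\<forall>t. A t \<in> sets borel)}"
  show "Int_stable ?E"
  proof (rule Int_stableI)
    fix a b assume "a \<in> ?E" "b \<in> ?E"
    then obtain T A T' A' where
      a: "a = {\<omega>. \<forall>t\<in>T. path_at \<omega> t \<in> A t}" "finite T" "T \<subseteq> {0..}" "\<And>t. A t \<in> sets borel" and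
      b: "b = {\<omega>. \<forall>t\<in>T'. path_at \<omega> t \<in> A' t}" "finite T'" "T' \<subseteq> {0..}" "\<And>t. A' t \<in> sets borel"
      by blast
    let ?A = "\<lambda>t. (if t \<in> T then A t else UNIV) \<inter> (if t \<in> T' then A' t else UNIV)"
    have "a \<inter> b = {\<omega>. \<forall>t\<in>T\<union>T'. path_at \<omega> t \<in> ?A t}" using a(1) b(1) by auto
    moreover have "\<forall>t. ?A t \<in> sets borel" using a(4) b(4) by auto
    ultimately show "a \<inter> b \<in> ?E" using a(2,3) b(2,3)
      by (intro CollectI exI[of _ "T \<union> T'"] exI[of _ ?A]) auto
  qed
  have E_borel: "?E \<subseteq> sets borel"
  proof safe
    fix T :: "real set" and A :: "real \<Rightarrow> real set" assume "finite T" "\<forall>t. A t \<in> sets borel"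
    then have "Measurable.pred borel (\<lambda>\<omega>. \<forall>t\<in>T. path_at \<omega> t \<in> A t)"
      by (intro pred_countable_Ball) (auto intro: countable_finite)
    then show "{\<omega>. \<forall>t\<in>T. path_at \<omega> t \<in> A t} \<in> sets borel" by (simp add: pred_def)
  qed
  have "sets (borel :: c0path measure) = sigma_sets UNIV ?E"
  proof
    show "sigma_sets UNIV ?E \<subseteq> sets borel"
      using sets.sigma_sets_subset[OF E_borel] by simp
    have "{(\<lambda>\<omega>. path_at \<omega> s) -` A | s A. 0 \<le> s \<and> ennreal s \<le> \<top> \<and> A \<in> sets (borel :: real measure)} \<subseteq> ?E"
    proof safe
      fix s :: real and A :: "real set" assume "0 \<le> s" "A \<in> sets borel"
      then show "\<exists>T A'. (\<lambda>\<omega>. path_at \<omega> s) -` A = {\<omega>. \<forall>t\<in>T. path_at \<omega> t \<in> A' t} \<and>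
          finite T \<and> T \<subseteq> {0..} \<and> (\<forall>t. A' t \<in> sets borel)"
        by (intro exI[of _ "{s}"] exI[of _ "\<lambda>_. A"]) auto
    qed
    then show "sets (borel :: c0path measure) \<subseteq> sigma_sets UNIV ?E"
      unfolding borel_eq_raw_top sets_raw_filtration by (rule sigma_sets_mono')
  qed
  then show "sets M = sigma_sets UNIV ?E" "sets N = sigma_sets UNIV ?E" by simp_all
  show "range (\<lambda>_::nat. UNIV) \<subseteq> ?E"
    by (auto intro!: exI[of _ "{}::real set"] exI[of _ "\<lambda>_. {}::real set"])
  show "(\<Union>i::nat. UNIV) = (UNIV :: c0path set)" by simp
  show "emeasure M UNIV \<noteq> \<infinity>" 
    using finite_measure.emeasure_finite[OF assms(1)] by simp
  show "emeasure M X = emeasure N X" if XE: "X \<in> ?E" for X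
  proof -
    obtain T A where X: "X = {\<omega>. \<forall>t\<in>T. path_at \<omega> t \<in> A t}" "finite T" "T \<subseteq> {0..}" "\<And>t. A t \<in> sets borel"
      using XE unfolding mem_Collect_eq by (elim exE conjE) (rule that, auto)
    let ?A = "\<lambda>t. if t \<in> T then A t else UNIV"
    have "X = {\<omega>. \<forall>t\<in>T \<union> F. path_at \<omega> t \<in> ?A t}" using X(1) by auto
    moreover have "emeasure M {\<omega>. \<forall>t\<in>T \<union> F. path_at \<omega> t \<in> ?A t} = emeasure N {\<omega>. \<forall>t\<in>T \<union> F. path_at \<omega> t \<in> ?A t}"
      by (rule eq) (use X(2-4) assms(4,5) in auto)
    ultimately show ?thesis by (simp only:)
  qed
qed auto

text \<open>Completing the square in the exponent; this is the Cameron-Martin formula for a single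
  increment.\<close>

lemma density_normal_exp:
  assumes "0 < \<sigma>"
  shows "density (density lborel (normal_density 0 \<sigma>)) (\<lambda>y. ennreal (exp (c * y - c\<^sup>2 * \<sigma>\<^sup>2 / 2)))
    = density lborel (normal_density (c * \<sigma>\<^sup>2) \<sigma>)"
proof -
  have "normal_density 0 \<sigma> y * exp (c * y - c\<^sup>2 * \<sigma>\<^sup>2 / 2) = normal_density (c * \<sigma>\<^sup>2) \<sigma> y" for y
  proof -
    have "- (y - 0)\<^sup>2 / (2 * \<sigma>\<^sup>2) + (c * y - c\<^sup>2 * \<sigma>\<^sup>2 / 2) = - (y - c * \<sigma>\<^sup>2)\<^sup>2 / (2 * \<sigma>\<^sup>2)"
      using assms by (simp add: field_simps power2_eq_square)
    then show ?thesis unfolding normal_density_def by (simp add: exp_add[symmetric])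
  qed
  then show ?thesis
    by (subst density_density_eq) (auto simp: ennreal_mult[symmetric] fun_eq_iff intro!: density_cong)
qed

text \<open>On boxes the integral of a product of one-coordinate functions factorizes, and boxes
  determine a product measure.\<close>

lemma density_PiM:
  assumes "finite I" and "\<And>i. sigma_finite_measure (M i)"
    and [measurable]: "\<And>i. z i \<in> borel_measurable (M i)"
    and "\<And>i. sigma_finite_measure (density (M i) (z i))"
  shows "density (PiM I M) (\<lambda>y. \<Prod>i\<in>I. z i (y i)) = PiM I (\<lambda>i. density (M i) (z i))"
proof -
  interpret M: product_sigma_finite M by (rule product_sigma_finite.intro[OF assms(2)])
  interpret N: product_sigma_finite "\<lambda>i. density (M i) (z i)" by (rule product_sigma_finite.intro[OF assms(4)])
  show ?thesis
  proof (rule N.PiM_eqI[OF assms(1)])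
    show "sets (density (PiM I M) (\<lambda>y. \<Prod>i\<in>I. z i (y i))) = sets (PiM I (\<lambda>i. density (M i) (z i)))"
      by (simp cong: sets_PiM_cong)
    fix A assume A: "\<And>i. i \<in> I \<Longrightarrow> A i \<in> sets (density (M i) (z i))"
    then have [measurable]: "\<And>i. i \<in> I \<Longrightarrow> A i \<in> sets (M i)" by simp
    have "emeasure (density (PiM I M) (\<lambda>y. \<Prod>i\<in>I. z i (y i))) (Pi\<^sub>E I A) =
      (\<integral>\<^sup>+y. (\<Prod>i\<in>I. z i (y i)) * indicator (Pi\<^sub>E I A) y \<partial>PiM I M)"
      using assms(1) by (subst emeasure_density) (auto intro!: sets_PiM_I_finite)
    also have "\<dots> = (\<integral>\<^sup>+y. (\<Prod>i\<in>I. z i (y i) * indicator (A i) (y i)) \<partial>PiM I M)"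
    proof (rule nn_integral_cong)
      fix y assume y: "y \<in> space (PiM I M)"
      have "indicator (Pi\<^sub>E I A) y = (\<Prod>i\<in>I. indicator (A i) (y i) :: ennreal)"
        using y assms(1) by (auto simp: indicator_def space_PiM PiE_def Pi_def prod.neutral intro!: prod_zero)
      then show "(\<Prod>i\<in>I. z i (y i)) * indicator (Pi\<^sub>E I A) y = (\<Prod>i\<in>I. z i (y i) * indicator (A i) (y i))"
        by (simp add: prod.distrib)
    qed
    also have "\<dots> = (\<Prod>i\<in>I. \<integral>\<^sup>+x. z i x * indicator (A i) x \<partial>M i)"
      by (rule M.product_nn_integral_prod[OF assms(1)]) auto
    also have "\<dots> = (\<Prod>i\<in>I. emeasure (density (M i) (z i)) (A i))"
      by (intro prod.cong refl) (simp add: emeasure_density)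
    finally show "emeasure (density (PiM I M) (\<lambda>y. \<Prod>i\<in>I. z i (y i))) (Pi\<^sub>E I A) = \<dots>" .
  qed
qed

text \<open>The translation is by a path that is linear between the points of the grid, so that the
  claim reduces to shifting the means of finitely many independent normal increments.\<close>
lemma cameron_martin_ramp:
  assumes W: "wiener_measure W" and a: "0 < a"
  shows "distr W borel (translate (ramp a) c) =
    density W (\<lambda>\<omega>. ennreal (exp (c * path_at \<omega> a - c\<^sup>2 * a / 2)))"
\<comment> \<open>The grid contains 0 so that path values are sums of increments, and
  \<open>a\<close> so that the ramp is linear on every grid cell.\<close>
proof (rule measure_eqI_cylinder[where F="{0, a}"])
  interpret prob_space W using W by (simp add: wiener_measure_def)
  have [measurable_cong, simp]: "sets W = sets borel" using W by (simp add: wiener_measure_def)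
  have spW [simp]: "space W = UNIV" using sets_eq_imp_space_eq[of W borel] by simp
  show "finite_measure (distr W borel (translate (ramp a) c))"
    by (intro finite_measure_distr) measurable
  show "{0, a} \<subseteq> {0..}" using a by auto
  fix T and A :: "real \<Rightarrow> real set"
  assume T: "finite T" "{0, a} \<subseteq> T" "T \<subseteq> {0..}" and A[measurable]: "\<And>t. A t \<in> sets borel"
  define xs where "xs = sorted_list_of_set T"
  have xs: "sorted_wrt (<) xs" "set xs = T" unfolding xs_def using T(1) by simp_all
  define n where "n = length xs - 1"
  define t where "t = (\<lambda>i. xs ! i)"
  have len: "length xs = Suc n" using xs(2) T(2) unfolding n_def by (cases xs) auto
  have mono: "t i < t j" if "i < j" "j \<le> n" for i j
    using sorted_wrt_nth_less[OF xs(1), of i j] that len unfolding t_def by auto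
  have T_eq: "T = t ` {..n}"
    using xs(2) unfolding t_def set_conv_nth len by (auto simp: less_Suc_eq_le)
  have "0 \<in> T" "a \<in> T" using T(2) by auto
  then obtain z p where z: "z \<le> n" "t z = 0" and p: "p \<le> n" "t p = a"
    unfolding T_eq by auto
  have "0 \<le> t 0" using T(3) unfolding T_eq by auto
  with z mono[of 0 z] have t0: "t 0 = 0" by (cases "z = 0") auto
  have p0: "0 < p" using t0 p a by (cases p) auto
  have t_le_a: "t (Suc i) \<le> a" if "i < p" for i
    using mono[of "Suc i" p] that p by (cases "Suc i = p") auto
  have t_ge_a: "a \<le> t i" if "p \<le> i" "i \<le> n" for i
    using mono[of p i] that p by (cases "i = p") auto
  have t_nonneg: "0 \<le> t i" if "i \<le> n" for i using T(3) that unfolding T_eq by auto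
  define Y where "Y i \<omega> = path_at \<omega> (t (Suc i)) - path_at \<omega> (t i)" for i \<omega>
  have Y_meas [measurable]: "Y i \<in> borel_measurable borel" for i unfolding Y_def by measurable
  \<comment> \<open>The value 1 off the grid is a dummy: it makes \<open>\<sigma> i\<close> positive
    for all \<open>i\<close>, as the product measures need a normal law at every index.\<close>
  define \<sigma> where "\<sigma> i = (if i < n then sqrt (t (Suc i) - t i) else 1)" for i
  have \<sigma>: "0 < \<sigma> i" "i < n \<Longrightarrow> (\<sigma> i)\<^sup>2 = t (Suc i) - t i" for i
    using mono[of i "Suc i"] unfolding \<sigma>_def by auto
  \<comment> \<open>The tilt of the \<open>i\<close>-th increment. Up to \<open>a\<close> the ramp
    has slope 1, so the translation shifts an increment by \<open>c\<close> times the length of its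
    cell, which is its variance; after \<open>a\<close> there is no shift.\<close>
  define r where "r i = (if i < p then c else 0)" for i
  have Y_dist: "distributed W lborel (Y i) (normal_density 0 (\<sigma> i))" if "i < n" for i
    using W t_nonneg[of i] mono[of i "Suc i"] that unfolding wiener_measure_def Y_def \<sigma>_def by auto
  have indep: "indep_vars (\<lambda>_. borel) Y {..<n}"
    using W t0 mono unfolding wiener_measure_def Y_def by (auto simp: Suc_le_eq)
  have n0: "{..<n} \<noteq> {}" using p p0 by (auto simp: lessThan_empty_iff)
  have translate_Y: "Y i (translate (ramp a) c \<omega>) = r i * (\<sigma> i)\<^sup>2 + Y i \<omega>" if "i < n" for i \<omega>
  proof (cases "i < p")
    case True
    then have "t (Suc i) \<le> a" "t i \<le> a" "0 \<le> t i" "0 \<le> t (Suc i)"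
      using t_le_a[of i] mono[of i "Suc i"] t_nonneg[of i] t_nonneg[of "Suc i"] that by auto
    then show ?thesis using True a unfolding Y_def r_def \<sigma>(2)[OF that] by (simp add: algebra_simps)
  next
    case False
    then have "a \<le> t (Suc i)" "a \<le> t i"
      using t_ge_a[of i] t_ge_a[of "Suc i"] that by auto
    then show ?thesis using False a unfolding Y_def r_def by simp
  qed
  let ?P = "\<Pi>\<^sub>M i\<in>{..<n}. (borel :: real measure)"
  let ?N = "\<lambda>i. density lborel (normal_density 0 (\<sigma> i))"
  let ?N' = "\<lambda>i. density lborel (normal_density (r i * (\<sigma> i)\<^sup>2) (\<sigma> i))"
  let ?z = "\<lambda>i y. ennreal (exp (r i * y - (r i)\<^sup>2 * (\<sigma> i)\<^sup>2 / 2))"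
  define D where "D \<omega> = (\<lambda>i\<in>{..<n}. Y i \<omega>)" for \<omega>
  have D_meas [measurable]: "D \<in> measurable borel ?P" unfolding D_def by measurable
  have D_distr: "distr W ?P D = PiM {..<n} ?N"
  proof -
    have "distr W ?P D = PiM {..<n} (\<lambda>i. distr W borel (Y i))"
      unfolding D_def using indep_vars_iff_distr_eq_PiM'[OF n0, where M'="\<lambda>_. borel" and X=Y] indep by simp
    also have "\<dots> = PiM {..<n} ?N"
      by (intro PiM_cong refl) (use distributed_distr_eq_density[OF Y_dist] in \<open>auto cong: distr_cong\<close>)
    finally show ?thesis .
  qed
  have D_distr': "distr W ?P (\<lambda>\<omega>. D (translate (ramp a) c \<omega>)) = PiM {..<n} ?N'"
  proof -
    let ?Y = "\<lambda>i \<omega>. r i * (\<sigma> i)\<^sup>2 + 1 * Y i \<omega>"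
    have "indep_vars (\<lambda>_. borel) (\<lambda>i. (\<lambda>y. r i * (\<sigma> i)\<^sup>2 + 1 * y) \<circ> Y i) {..<n}"
      by (rule indep_vars_compose[OF indep]) measurable
    then have i': "indep_vars (\<lambda>_. borel) ?Y {..<n}" by (simp add: comp_def)
    have "(\<lambda>\<omega>. D (translate (ramp a) c \<omega>)) = (\<lambda>\<omega>. \<lambda>i\<in>{..<n}. ?Y i \<omega>)"
      unfolding D_def by (auto simp: translate_Y fun_eq_iff restrict_def)
    then have "distr W ?P (\<lambda>\<omega>. D (translate (ramp a) c \<omega>)) = PiM {..<n} (\<lambda>i. distr W borel (?Y i))"
      using indep_vars_iff_distr_eq_PiM'[OF n0, where M'="\<lambda>_. borel" and X="?Y"] i' by simp
    also have "\<dots> = PiM {..<n} ?N'"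
    proof (intro PiM_cong refl)
      fix i assume "i \<in> {..<n}"
      then have "distributed W lborel (?Y i) (normal_density (r i * (\<sigma> i)\<^sup>2 + 1 * 0) (\<bar>1\<bar> * \<sigma> i))"
        by (intro normal_density_affine Y_dist \<sigma>) auto
      from distributed_distr_eq_density[OF this]
      show "distr W borel (?Y i) = ?N' i" by (simp cong: distr_cong)
    qed
    finally show ?thesis .
  qed
  have density_z: "density (PiM {..<n} ?N) (\<lambda>y. \<Prod>i<n. ?z i (y i)) = PiM {..<n} ?N'"
  proof -
    have "density (PiM {..<n} ?N) (\<lambda>y. \<Prod>i<n. ?z i (y i)) = PiM {..<n} (\<lambda>i. density (?N i) (?z i))"
      by (rule density_PiM)
         (auto intro!: prob_space_imp_sigma_finite prob_space_normal_density \<sigma>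
               simp: density_normal_exp[OF \<sigma>(1)])
    then show ?thesis by (simp add: density_normal_exp[OF \<sigma>(1)])
  qed
  \<comment> \<open>Factors from \<open>p\<close> on are 1, and the remaining sums telescope between
    \<open>t 0 = 0\<close> and \<open>t p = a\<close>.\<close>
  have prod_z: "(\<Prod>i<n. ?z i (D \<omega> i)) = ennreal (exp (c * path_at \<omega> a - c\<^sup>2 * a / 2))" for \<omega>
  proof -
    have "(\<Prod>i<n. ?z i (D \<omega> i)) = (\<Prod>i<n. ?z i (Y i \<omega>))"
      by (intro prod.cong) (auto simp: D_def)
    also have "\<dots> = (\<Prod>i<p. ?z i (Y i \<omega>))"
      using p(1) by (intro prod.mono_neutral_right) (auto simp: r_def)
    also have "\<dots> = ennreal (exp (\<Sum>i<p. r i * Y i \<omega> - (r i)\<^sup>2 * (\<sigma> i)\<^sup>2 / 2))"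
      by (simp add: prod_ennreal exp_sum)
    also have "(\<Sum>i<p. r i * Y i \<omega> - (r i)\<^sup>2 * (\<sigma> i)\<^sup>2 / 2) =
        (\<Sum>i<p. c * (path_at \<omega> (t (Suc i)) - path_at \<omega> (t i)) - c\<^sup>2 / 2 * (t (Suc i) - t i))"
      using p(1) by (intro sum.cong refl) (auto simp: r_def \<sigma>(2) Y_def)
    also have "\<dots> = c * (\<Sum>i<p. path_at \<omega> (t (Suc i)) - path_at \<omega> (t i)) - c\<^sup>2 / 2 * (\<Sum>i<p. t (Suc i) - t i)"
      by (simp only: sum_distrib_left sum_subtractf[symmetric])
    also have "\<dots> = c * path_at \<omega> a - c\<^sup>2 * a / 2"
      using sum_lessThan_telescope[of "\<lambda>i. path_at \<omega> (t i)" p] sum_lessThan_telescope[of t p] p(2) t0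
      by simp
    finally show ?thesis .
  qed
  \<comment> \<open>The cylinder in the coordinates of the increments: as the path starts at 0, its
    grid values are their partial sums.\<close>
  define C where "C = {y \<in> space ?P. \<forall>i\<in>{..n}. (\<Sum>j<i. y j) \<in> A (t i)}"
  have C_meas [measurable]: "C \<in> sets ?P"
  proof -
    have "Measurable.pred ?P (\<lambda>y. (\<Sum>j<i. y j) \<in> A (t i))" if "i \<in> {..n}" for i
    proof -
      have [measurable]: "(\<lambda>y. y j) \<in> borel_measurable ?P" if "j \<in> {..<i}" for j
        using that \<open>i \<in> {..n}\<close> by (intro measurable_component_singleton) auto
      have [measurable]: "(\<lambda>y. \<Sum>j<i. y j) \<in> borel_measurable ?P"
        by (rule borel_measurable_sum) measurable
      show ?thesis by measurable
    qed
    then have "Measurable.pred ?P (\<lambda>y. \<forall>i\<in>{..n}. (\<Sum>j<i. y j) \<in> A (t i))"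
      by (intro pred_countable_Ball) auto
    then show ?thesis by (simp add: C_def pred_def)
  qed
  have D_C: "D \<omega> \<in> C \<longleftrightarrow> (\<forall>u\<in>T. path_at \<omega> u \<in> A u)" for \<omega>
  proof -
    have "(\<Sum>j<i. D \<omega> j) = path_at \<omega> (t i)" if "i \<le> n" for i
    proof -
      have "(\<Sum>j<i. D \<omega> j) = (\<Sum>j<i. path_at \<omega> (t (Suc j)) - path_at \<omega> (t j))"
        using that by (intro sum.cong) (auto simp: D_def Y_def)
      then show ?thesis
        using sum_lessThan_telescope[of "\<lambda>i. path_at \<omega> (t i)" i] t0 by simp
    qed
    then show ?thesis
      unfolding C_def T_eq by (simp add: D_def space_PiM)
  qed
  let ?S = "{\<omega>. \<forall>u\<in>T. path_at \<omega> u \<in> A u}"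
  have S: "?S = D -` C" by (auto simp: D_C)
  have S_meas: "?S \<in> sets borel" unfolding S using measurable_sets[OF D_meas C_meas] by simp
  have "emeasure (distr W borel (translate (ramp a) c)) ?S = emeasure W ((\<lambda>\<omega>. D (translate (ramp a) c \<omega>)) -` C)"
    using S_meas by (subst emeasure_distr) (auto simp: S vimage_def)
  also have "\<dots> = emeasure (distr W ?P (\<lambda>\<omega>. D (translate (ramp a) c \<omega>))) C"
    by (subst emeasure_distr) auto
  also have "\<dots> = emeasure (density (distr W ?P D) (\<lambda>y. \<Prod>i<n. ?z i (y i))) C"
    by (simp only: D_distr' D_distr density_z)
  also have "\<dots> = (\<integral>\<^sup>+y. (\<Prod>i<n. ?z i (y i)) * indicator C y \<partial>distr W ?P D)"
    by (subst emeasure_density) auto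
  also have "\<dots> = (\<integral>\<^sup>+\<omega>. (\<Prod>i<n. ?z i (D \<omega> i)) * indicator C (D \<omega>) \<partial>W)"
    by (subst nn_integral_distr) auto
  also have "\<dots> = emeasure (density W (\<lambda>\<omega>. ennreal (exp (c * path_at \<omega> a - c\<^sup>2 * a / 2)))) ?S"
    using S_meas by (subst emeasure_density) (auto simp: prod_z S indicator_def intro!: nn_integral_cong)
  finally show "emeasure (distr W borel (translate (ramp a) c)) ?S = \<dots>" .
qed (use W in \<open>auto simp: wiener_measure_def\<close>)

subsection \<open>Resampling a Gaussian coordinate\<close>

lemma measurable_translate_pair [measurable]:
  "(\<lambda>(c, \<omega>). translate h c \<omega>) \<in> borel \<Otimes>\<^sub>M borel \<rightarrow>\<^sub>M borel"
  by (rule measurable_into_borel_c0path) (simp add: case_prod_beta)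

text \<open>The Faber-Schauder hat on \<open>[0,s]\<close> with peak 1 at
  \<open>s/2\<close>.\<close>

definition tent :: "real \<Rightarrow> c0path" where
  "tent s = Abs_c0path (\<lambda>t. max 0 (1 - \<bar>2 * t / s - 1\<bar>))"

lemma path_at_tent: "0 < s \<Longrightarrow> path_at (tent s) t = max 0 (1 - \<bar>2 * t / s - 1\<bar>)"
proof -
  assume s: "0 < s"
  have "continuous_on {0..} (\<lambda>t. max 0 (1 - \<bar>2 * t / s - 1\<bar>))"
    using s by (intro continuous_intros) auto
  moreover have "max 0 (1 - \<bar>2 * t / s - 1\<bar>) = 0" if "t < 0" for t
  proof -
    have "2 * t / s < 0" using that s by (simp add: divide_less_0_iff)
    then show ?thesis by linarith
  qed
  ultimately show ?thesis
    unfolding tent_def by (subst Abs_c0path_inverse) auto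
qed

lemma path_at_tent_eq_0: "0 < s \<Longrightarrow> s \<le> t \<Longrightarrow> path_at (tent s) t = 0"
  by (simp add: path_at_tent field_simps max_def abs_if)

text \<open>The Schauder coefficient: the deviation at \<open>s/2\<close> from the chord over
  \<open>[0,s]\<close>, which is the midpoint value of the associated Brownian bridge.\<close>

definition mid :: "real \<Rightarrow> c0path \<Rightarrow> real" where
  "mid s \<omega> = path_at \<omega> (s / 2) - path_at \<omega> s / 2"

lemma measurable_mid [measurable]: "mid s \<in> borel_measurable borel"
  unfolding mid_def by measurable

lemma mid_translate_tent: "0 < s \<Longrightarrow> mid s (translate (tent s) c \<omega>) = mid s \<omega> + c"
  by (simp add: mid_def path_at_tent)

text \<open>Slopes determine the coefficients: the tent rises with slope \<open>2/s\<close> and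
  falls with slope \<open>-2/s\<close>, so the ramp up to \<open>s\<close> has weight
  \<open>-2/s\<close> and the ramp up to \<open>s/2\<close> has weight \<open>4/s\<close>.\<close>

lemma translate_tent_eq:
  assumes "0 < s"
  shows "translate (tent s) c \<omega> =
    translate (ramp s) (- (2 * c / s)) (translate (ramp (s / 2)) (4 * c / s) \<omega>)"
proof (rule c0path_eqI)
  fix t :: real assume "0 \<le> t"
  consider "t \<le> s / 2" | "s / 2 < t" "t \<le> s" | "s < t" by linarith
  then show "path_at (translate (tent s) c \<omega>) t =
    path_at (translate (ramp s) (- (2 * c / s)) (translate (ramp (s / 2)) (4 * c / s) \<omega>)) t"
  proof cases
    case 1
    then have "2 * t / s \<le> 1" "0 \<le> 2 * t / s" using assms \<open>0 \<le> t\<close> by (auto simp: field_simps)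
    then show ?thesis using 1 assms \<open>0 \<le> t\<close> by (simp add: path_at_tent max_def field_simps)
  next
    case 2
    then have "1 \<le> 2 * t / s" "2 * t / s \<le> 2" using assms by (auto simp: field_simps)
    then show ?thesis using 2 assms \<open>0 \<le> t\<close> by (simp add: path_at_tent max_def field_simps)
  next
    case 3
    then show ?thesis using assms by (simp add: path_at_tent_eq_0 field_simps)
  qed
qed

lemma cameron_martin_ramp_nn_integral:
  assumes W: "wiener_measure W" and a: "0 < a" and [measurable]: "f \<in> borel_measurable borel"
  shows "(\<integral>\<^sup>+\<omega>. f (translate (ramp a) c \<omega>) \<partial>W) =
    (\<integral>\<^sup>+\<omega>. f \<omega> * ennreal (exp (c * path_at \<omega> a - c\<^sup>2 * a / 2)) \<partial>W)"
proof -
  have [measurable_cong]: "sets W = sets borel" using W by (simp add: wiener_measure_def)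
  have "(\<integral>\<^sup>+\<omega>. f (translate (ramp a) c \<omega>) \<partial>W) = (\<integral>\<^sup>+\<omega>. f \<omega> \<partial>distr W borel (translate (ramp a) c))"
    by (subst nn_integral_distr) auto
  also have "\<dots> = (\<integral>\<^sup>+\<omega>. f \<omega> * ennreal (exp (c * path_at \<omega> a - c\<^sup>2 * a / 2)) \<partial>W)"
    unfolding cameron_martin_ramp[OF W a] by (subst nn_integral_density) (auto simp: mult.commute)
  finally show ?thesis .
qed

text \<open>The densities of the two ramps combine into a function of \<open>mid s\<close> alone,
  the likelihood ratio of normal laws with variance \<open>s/4\<close> and means \<open>c\<close>
  and 0. So the translation moves the coefficient and nothing else.\<close>

lemma cameron_martin_tent:
  assumes W: "wiener_measure W" and s: "0 < s" and [measurable]: "f \<in> borel_measurable borel"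
  shows "(\<integral>\<^sup>+\<omega>. f (translate (tent s) c \<omega>) \<partial>W) =
    (\<integral>\<^sup>+\<omega>. f \<omega> * ennreal (exp (4 * c * mid s \<omega> / s - 2 * c\<^sup>2 / s)) \<partial>W)"
proof -
  let ?c1 = "4 * c / s" and ?c2 = "- (2 * c / s)"
  let ?g = "\<lambda>\<omega>. f (translate (ramp s) ?c2 \<omega>)"
  let ?z = "\<lambda>\<omega>. ennreal (exp (?c1 * path_at \<omega> (s/2) - ?c1\<^sup>2 * (s/2) / 2))"
  \<comment> \<open>\<open>?z\<close> as a function of the path after the second translation, which
    moves the value at \<open>s/2\<close> by \<open>?c2 * (s/2)\<close>; the shift is
    undone.\<close>
  let ?z' = "\<lambda>\<omega>. ennreal (exp (?c1 * (path_at \<omega> (s/2) - ?c2 * (s/2)) - ?c1\<^sup>2 * (s/2) / 2))"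
  have "(\<integral>\<^sup>+\<omega>. f (translate (tent s) c \<omega>) \<partial>W) = (\<integral>\<^sup>+\<omega>. ?g (translate (ramp (s/2)) ?c1 \<omega>) \<partial>W)"
    using s by (simp add: translate_tent_eq)
  also have "\<dots> = (\<integral>\<^sup>+\<omega>. ?g \<omega> * ?z \<omega> \<partial>W)"
    using s by (intro cameron_martin_ramp_nn_integral[OF W]) auto
  also have "\<dots> = (\<integral>\<^sup>+\<omega>. (\<lambda>\<omega>. f \<omega> * ?z' \<omega>) (translate (ramp s) ?c2 \<omega>) \<partial>W)"
    using s by (simp add: max_def)
  also have "\<dots> = (\<integral>\<^sup>+\<omega>. f \<omega> * ?z' \<omega> * ennreal (exp (?c2 * path_at \<omega> s - ?c2\<^sup>2 * s / 2)) \<partial>W)"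
    by (rule cameron_martin_ramp_nn_integral[OF W s]) measurable
  also have "\<dots> = (\<integral>\<^sup>+\<omega>. f \<omega> * ennreal (exp (4 * c * mid s \<omega> / s - 2 * c\<^sup>2 / s)) \<partial>W)"
  proof (intro nn_integral_cong)
    fix \<omega>
    have "?c1 * (path_at \<omega> (s/2) - ?c2 * (s/2)) - ?c1\<^sup>2 * (s/2) / 2 + (?c2 * path_at \<omega> s - ?c2\<^sup>2 * s / 2)
      = 4 * c * mid s \<omega> / s - 2 * c\<^sup>2 / s"
      using s by (simp add: mid_def field_simps power2_eq_square)
    then show "f \<omega> * ?z' \<omega> * ennreal (exp (?c2 * path_at \<omega> s - ?c2\<^sup>2 * s / 2)) =
        f \<omega> * ennreal (exp (4 * c * mid s \<omega> / s - 2 * c\<^sup>2 / s))"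
      by (simp add: mult.assoc ennreal_mult[symmetric] exp_add[symmetric])
  qed
  finally show ?thesis .
qed

text \<open>Overwrites the tent coefficient by \<open>x\<close>; the result depends on
  \<open>\<omega>\<close> only through the remainder of the path.\<close>

definition resample :: "real \<Rightarrow> c0path \<Rightarrow> real \<Rightarrow> c0path" where
  "resample s \<omega> x = translate (tent s) (x - mid s \<omega>) \<omega>"

text \<open>The variance is that of the Brownian bridge at its midpoint:
  \<open>s/2 + s/4 - s/2 = s/4\<close>.\<close>

definition mid_law :: "real \<Rightarrow> real measure" where
  "mid_law s = density lborel (normal_density 0 (sqrt s / 2))"

lemma sets_mid_law [simp, measurable_cong]: "sets (mid_law s) = sets borel"
  by (simp add: mid_law_def)

lemma space_mid_law [simp]: "space (mid_law s) = UNIV"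
  by (simp add: mid_law_def)

lemma prob_space_mid_law: "0 < s \<Longrightarrow> prob_space (mid_law s)"
  unfolding mid_law_def by (rule prob_space_normal_density) simp

lemma mid_resample: "0 < s \<Longrightarrow> mid s (resample s \<omega> x) = x"
  by (simp add: resample_def mid_translate_tent)

lemma resample_resample: "0 < s \<Longrightarrow> resample s (resample s \<omega> x) y = resample s \<omega> y"
  by (rule c0path_eqI) (simp add: resample_def mid_translate_tent algebra_simps)

lemma path_at_resample_ge: "0 < s \<Longrightarrow> s \<le> t \<Longrightarrow> path_at (resample s \<omega> x) t = path_at \<omega> t"
  by (simp add: resample_def path_at_tent_eq_0)

text \<open>This says that \<^term>\<open>mid s\<close> is normal and independent of the remainder of the path; the
  proof integrates the Cameron-Martin formula over all multiples of the tent function.\<close>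
lemma nn_integral_resample:
  assumes W: "wiener_measure W" and s: "0 < s" and [measurable]: "f \<in> borel_measurable borel"
  shows "(\<integral>\<^sup>+\<omega>. f \<omega> \<partial>W) = (\<integral>\<^sup>+\<omega>. (\<integral>\<^sup>+x. f (resample s \<omega> x) \<partial>mid_law s) \<partial>W)"
proof -
  interpret prob_space W using W by (simp add: wiener_measure_def)
  interpret pair_sigma_finite W "lborel :: real measure" ..
  have [measurable_cong]: "sets W = sets borel" using W by (simp add: wiener_measure_def)
  let ?p = "normal_density 0 (sqrt s / 2)"
  have "(\<integral>\<^sup>+\<omega>. (\<integral>\<^sup>+x. f (resample s \<omega> x) \<partial>mid_law s) \<partial>W) =
    (\<integral>\<^sup>+\<omega>. (\<integral>\<^sup>+x. f (translate (tent s) (x - mid s \<omega>) \<omega>) * ennreal (?p x) \<partial>lborel) \<partial>W)"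
    unfolding mid_law_def resample_def
    by (subst nn_integral_density) (auto simp: mult.commute)
  also have "\<dots> = (\<integral>\<^sup>+\<omega>. (\<integral>\<^sup>+c. f (translate (tent s) c \<omega>) * ennreal (?p (mid s \<omega> + c)) \<partial>lborel) \<partial>W)"
  proof (rule nn_integral_cong)
    fix \<omega>
    show "(\<integral>\<^sup>+x. f (translate (tent s) (x - mid s \<omega>) \<omega>) * ennreal (?p x) \<partial>lborel) =
      (\<integral>\<^sup>+c. f (translate (tent s) c \<omega>) * ennreal (?p (mid s \<omega> + c)) \<partial>lborel)"
      by (subst nn_integral_real_affine[where c=1 and t="mid s \<omega>"]) auto
  qed
  also have "\<dots> = (\<integral>\<^sup>+c. (\<integral>\<^sup>+\<omega>. f (translate (tent s) c \<omega>) * ennreal (?p (mid s \<omega> + c)) \<partial>W) \<partial>lborel)"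
    by (rule Fubini'[symmetric]) measurable
  \<comment> \<open>\<open>mid s \<omega> + c\<close> is the coefficient of the translated path, so
    the whole integrand is a function of that path and the Cameron-Martin formula applies for each
    fixed \<open>c\<close>.\<close>
  also have "\<dots> = (\<integral>\<^sup>+c. (\<integral>\<^sup>+\<omega>. (\<lambda>\<omega>. f \<omega> * ennreal (?p (mid s \<omega>))) (translate (tent s) c \<omega>) \<partial>W) \<partial>lborel)"
    using s by (simp add: mid_translate_tent)
  also have "\<dots> = (\<integral>\<^sup>+c. (\<integral>\<^sup>+\<omega>. f \<omega> * ennreal (?p (mid s \<omega>)) *
      ennreal (exp (4 * c * mid s \<omega> / s - 2 * c\<^sup>2 / s)) \<partial>W) \<partial>lborel)"
    by (intro nn_integral_cong cameron_martin_tent[OF W s]) measurable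
  also have "\<dots> = (\<integral>\<^sup>+\<omega>. (\<integral>\<^sup>+c. f \<omega> * ennreal (?p (mid s \<omega>)) *
      ennreal (exp (4 * c * mid s \<omega> / s - 2 * c\<^sup>2 / s)) \<partial>lborel) \<partial>W)"
    by (rule Fubini') measurable
  \<comment> \<open>The normal density at the coefficient times the likelihood ratio is the normal
    density in \<open>c\<close> centred at the coefficient, which integrates to 1 over
    \<open>c\<close>.\<close>
  also have "\<dots> = (\<integral>\<^sup>+\<omega>. (\<integral>\<^sup>+c. f \<omega> * ennreal (normal_density (mid s \<omega>) (sqrt s / 2) c) \<partial>lborel) \<partial>W)"
  proof (intro nn_integral_cong)
    fix \<omega> c
    let ?m = "mid s \<omega>"
    have "- (?m - 0)\<^sup>2 / (2 * (sqrt s / 2)\<^sup>2) + (4 * c * ?m / s - 2 * c\<^sup>2 / s) = - (c - ?m)\<^sup>2 / (2 * (sqrt s / 2)\<^sup>2)"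
      using s by (simp add: field_simps power2_eq_square)
    then have "?p ?m * exp (4 * c * ?m / s - 2 * c\<^sup>2 / s) = normal_density ?m (sqrt s / 2) c"
      unfolding normal_density_def by (simp only: mult.assoc exp_add[symmetric])
    then show "f \<omega> * ennreal (?p ?m) * ennreal (exp (4 * c * ?m / s - 2 * c\<^sup>2 / s)) =
        f \<omega> * ennreal (normal_density ?m (sqrt s / 2) c)"
      by (simp add: mult.assoc ennreal_mult[symmetric])
  qed
  also have "\<dots> = (\<integral>\<^sup>+\<omega>. f \<omega> \<partial>W)"
  proof (intro nn_integral_cong)
    fix \<omega>
    have "(\<integral>\<^sup>+c. ennreal (normal_density (mid s \<omega>) (sqrt s / 2) c) \<partial>lborel) = 1"
      using prob_space.emeasure_space_1[OF prob_space_normal_density[of "sqrt s / 2" "mid s \<omega>"]] s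
      by (simp add: emeasure_density)
    then show "(\<integral>\<^sup>+c. f \<omega> * ennreal (normal_density (mid s \<omega>) (sqrt s / 2) c) \<partial>lborel) = f \<omega>"
      by (subst nn_integral_cmult) auto
  qed
  finally show ?thesis ..
qed

subsection \<open>The derandomized stopping time\<close>

text \<open>The probability integral transform, not normalized. Without atoms the distribution
  function is continuous, so a nonempty proper sublevel set is a closed half-line at whose endpoint
  the value \<open>v\<close> is attained.\<close>

lemma emeasure_cdf_le:
  fixes M :: "real measure"
  assumes "finite_measure M" and [simp]: "sets M = sets borel"
    and atom: "\<And>x. emeasure M {x} = 0" and v: "v \<le> emeasure M UNIV"
  shows "emeasure M {x. emeasure M {..x} \<le> v} = v"
proof -
  interpret finite_borel_measure M
    using assms(1,2) by (simp add: finite_borel_measure_def finite_borel_measure_axioms_def)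
  have [simp]: "space M = UNIV" using sets_eq_imp_space_eq[of M borel] by simp
  have v_fin: "v < \<top>" by (metis emeasure_finite infinity_ennreal_def le_less_trans less_top v)
  define r where "r = enn2real v"
  have r: "v = ennreal r" "0 \<le> r" using v_fin unfolding r_def by auto
  have F: "emeasure M {..x} = ennreal (cdf M x)" for x
    unfolding cdf_def2 by (rule emeasure_eq_measure)
  have set_eq: "{x. emeasure M {..x} \<le> v} = {x. cdf M x \<le> r}"
    unfolding F r(1) using r(2) by (simp add: ennreal_le_iff)
  have isCont: "isCont (cdf M) x" for x
    using atom[of x] by (simp add: isCont_cdf measure_def)
  then have cont: "continuous_on UNIV (cdf M)" by (simp add: continuous_on_eq_continuous_at)
  have r_le: "r \<le> measure M (space M)"
    using v r by (simp add: emeasure_eq_measure ennreal_le_iff)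
  show ?thesis
  \<comment> \<open>At full mass the sublevel set is the whole line and has no endpoint; below it
    some \<open>b\<close> lies above the level and bounds the set.\<close>
  proof (cases "r = measure M (space M)")
    case True
    then have U: "{x. cdf M x \<le> r} = UNIV" using cdf_bounded by auto
    show ?thesis unfolding set_eq U using True r(1) by (simp add: emeasure_eq_measure)
  next
    case False
    then have "r < measure M (space M)" using r_le by simp
    with cdf_lim_at_top have "eventually (\<lambda>x. r < cdf M x) at_top" by (rule order_tendstoD)
    then obtain b where b: "r < cdf M b" unfolding eventually_at_top_linorder by blast
    show ?thesis
    proof (cases "\<exists>x. cdf M x \<le> r")
      case nonempty: True
      let ?S = "{x. cdf M x \<le> r}"
      have bdd: "bdd_above ?S"
      proof (rule bdd_aboveI[of _ b])
        fix y assume "y \<in> ?S"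
        then show "y \<le> b" using b cdf_nondecreasing[of b y] by (cases "y \<le> b") auto
      qed
      have "closed ?S" using cont by (intro closed_Collect_le) (auto intro: continuous_on_const)
      then have mem: "Sup ?S \<in> ?S" using closed_contains_Sup[of ?S] nonempty bdd by auto
      have S_eq: "?S = {..Sup ?S}"
      proof (intro equalityI subsetI)
        fix y assume "y \<in> {..Sup ?S}"
        then show "y \<in> ?S" using mem cdf_nondecreasing[of y "Sup ?S"] by auto
      qed (use cSup_upper[OF _ bdd] in simp)
      \<comment> \<open>The value at the endpoint is at most \<open>r\<close> by closedness; the
        intermediate value theorem produces a point with value exactly \<open>r\<close>, and that
        point cannot lie beyond the supremum.\<close>
      have "\<exists>x\<ge>Sup ?S. x \<le> b \<and> cdf M x = r"
      proof (rule IVT)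
        show "Sup ?S \<le> b" using mem b cdf_nondecreasing[of b "Sup ?S"] by (cases "Sup ?S \<le> b") auto
      qed (use mem b isCont in auto)
      then obtain x where "Sup ?S \<le> x" "cdf M x = r" by blast
      then have "cdf M (Sup ?S) = r"
        using cSup_upper[OF _ bdd, of x] by auto
      then have "emeasure M ?S = ennreal r" by (subst S_eq) (simp add: F)
      then show ?thesis unfolding set_eq using r(1) by simp
    next
      case empty: False
      \<comment> \<open>The distribution function tends to 0 at minus infinity, so an empty sublevel
        set excludes positive levels.\<close>
      have "r = 0"
      proof (rule ccontr)
        assume "r \<noteq> 0"
        with r(2) have "0 < r" by simp
        with cdf_lim_at_bot have "eventually (\<lambda>x. cdf M x < r) at_bot" by (rule order_tendstoD)
        then show False using empty by (auto simp: eventually_at_bot_linorder not_le dest: less_asym)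
      qed
      moreover have "{x. cdf M x \<le> r} = {}" using empty by auto
      ultimately show ?thesis unfolding set_eq using r(1) by simp
    qed
  qed
qed

section \<open>Coefficients that keep the path inside the ball, and their adaptedness\<close>

definition alive :: "real \<Rightarrow> real \<Rightarrow> c0path \<Rightarrow> real set" where
  "alive \<eta> s \<omega> = {x. s < tau_eta \<eta> (resample s \<omega> x)}"

text \<open>Neither this nor \<open>alive_mass\<close> is divided by the mass of
  \<open>alive\<close>: the factor would cancel when the two are compared, and an alive set of
  measure zero causes no trouble.\<close>

definition alive_cdf :: "real \<Rightarrow> real \<Rightarrow> c0path \<Rightarrow> ennreal" where
  "alive_cdf \<eta> s \<omega> = emeasure (mid_law s) (alive \<eta> s \<omega> \<inter> {..mid s \<omega>})"

definition alive_mass :: "real \<Rightarrow> (c0path \<Rightarrow> real measure) \<Rightarrow> real \<Rightarrow> c0path \<Rightarrow> real \<Rightarrow> ennreal" where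
  "alive_mass \<eta> \<kappa> s \<omega> t =
     (\<integral>\<^sup>+x. indicator (alive \<eta> s \<omega>) x * emeasure (\<kappa> (resample s \<omega> x)) {0..t} \<partial>mid_law s)"

text \<open>Besides the coordinate in question only those at \<open>s/2\<close> and \<open>s\<close>
  enter, and both times are at most \<open>t\<close>.\<close>

lemma measurable_resample_raw:
  assumes "0 < s" "s \<le> t"
  shows "(\<lambda>(\<omega>, x). resample s \<omega> x) \<in> raw_filtration (ennreal t) \<Otimes>\<^sub>M borel \<rightarrow>\<^sub>M raw_filtration (ennreal t)"
proof (rule measurable_into_raw)
  fix u assume u: "0 \<le> u" "ennreal u \<le> ennreal t"
  have [measurable]: "(\<lambda>\<omega>. path_at \<omega> u) \<in> borel_measurable (raw_filtration (ennreal t))"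
    "(\<lambda>\<omega>. path_at \<omega> s) \<in> borel_measurable (raw_filtration (ennreal t))"
    "(\<lambda>\<omega>. path_at \<omega> (s / 2)) \<in> borel_measurable (raw_filtration (ennreal t))"
    using assms u by (auto intro!: measurable_path_at_raw ennreal_leI)
  show "(\<lambda>p. path_at (case p of (\<omega>, x) \<Rightarrow> resample s \<omega> x) u)
      \<in> borel_measurable (raw_filtration (ennreal t) \<Otimes>\<^sub>M borel)"
    unfolding resample_def mid_def case_prod_beta path_at_translate by measurable
qed auto

lemma measurable_resample [measurable]: "(\<lambda>(\<omega>, x). resample s \<omega> x) \<in> borel \<Otimes>\<^sub>M borel \<rightarrow>\<^sub>M borel"
  unfolding resample_def by measurable

text \<open>Resampling at \<open>s \<le> t\<close> reads no coordinate after \<open>t\<close>,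
  survival up to \<open>s\<close> and the kernel on \<open>[0,t]\<close> are known at
  \<open>t\<close>, and integrating over the coefficient preserves measurability.\<close>

lemma measurable_alive_raw:
  assumes "0 < \<eta>" "0 < s" "s \<le> t"
    and \<kappa>: "(\<lambda>\<omega>. emeasure (\<kappa> \<omega>) {0..t}) \<in> borel_measurable (raw_filtration (ennreal t))"
  shows "alive_cdf \<eta> s \<in> borel_measurable (raw_filtration (ennreal t))"
    "(\<lambda>\<omega>. alive_mass \<eta> \<kappa> s \<omega> t) \<in> borel_measurable (raw_filtration (ennreal t))"
proof -
  interpret prob_space "mid_law s" by (rule prob_space_mid_law[OF assms(2)])
  note [measurable] = measurable_resample_raw[OF assms(2,3)]
  have [measurable]: "Measurable.pred (raw_filtration (ennreal t)) (\<lambda>\<omega>. s < tau_eta \<eta> \<omega>)"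
    using assms by (intro pred_tau_eta_le) auto
  have [measurable]: "(\<lambda>\<omega>. path_at \<omega> s) \<in> borel_measurable (raw_filtration (ennreal t))"
    "(\<lambda>\<omega>. path_at \<omega> (s / 2)) \<in> borel_measurable (raw_filtration (ennreal t))"
    using assms by (auto intro!: measurable_path_at_raw ennreal_leI)
  have [measurable]: "mid s \<in> borel_measurable (raw_filtration (ennreal t))"
    unfolding mid_def by measurable
  note [measurable] = \<kappa>
  let ?M = "raw_filtration (ennreal t) \<Otimes>\<^sub>M mid_law s"
  have [measurable]: "Measurable.pred ?M (\<lambda>p. snd p \<in> alive \<eta> s (fst p))"
  proof -
    have "Measurable.pred ?M (\<lambda>p. s < tau_eta \<eta> (case p of (\<omega>, x) \<Rightarrow> resample s \<omega> x))"
      by measurable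
    then show ?thesis by (simp add: alive_def case_prod_beta)
  qed
  have "{p \<in> space ?M. snd p \<in> alive \<eta> s (fst p) \<and> snd p \<le> mid s (fst p)} \<in> sets ?M" (is "?Q \<in> _")
    by measurable
  from measurable_emeasure_Pair[OF this]
  have "(\<lambda>\<omega>. emeasure (mid_law s) (Pair \<omega> -` ?Q)) \<in> borel_measurable (raw_filtration (ennreal t))" .
  also have "(\<lambda>\<omega>. emeasure (mid_law s) (Pair \<omega> -` ?Q)) = alive_cdf \<eta> s"
    by (auto simp: alive_cdf_def fun_eq_iff space_pair_measure intro!: arg_cong[where f="emeasure _"])
  finally show "alive_cdf \<eta> s \<in> borel_measurable (raw_filtration (ennreal t))" .
  have "(\<lambda>p. emeasure (\<kappa> (case p of (\<omega>, x) \<Rightarrow> resample s \<omega> x)) {0..t}) \<in> borel_measurable ?M"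
    by measurable
  then have [measurable]: "(\<lambda>p. emeasure (\<kappa> (resample s (fst p) (snd p))) {0..t}) \<in> borel_measurable ?M"
    by (simp add: case_prod_beta)
  show "(\<lambda>\<omega>. alive_mass \<eta> \<kappa> s \<omega> t) \<in> borel_measurable (raw_filtration (ennreal t))"
    unfolding alive_mass_def by (rule borel_measurable_nn_integral) (simp add: case_prod_beta)
qed

section \<open>The dyadic level and the stopping rule\<close>

definition level :: "real \<Rightarrow> c0path \<Rightarrow> nat" where
  "level \<eta> \<omega> = (LEAST n. \<eta> / 2 ^ n < tau_eta \<eta> \<omega>)"

lemma level_less:
  assumes "0 < \<eta>"
  shows "\<eta> / 2 ^ level \<eta> \<omega> < tau_eta \<eta> \<omega>"
proof -
  have "(\<lambda>n. \<eta> * (1 / 2) ^ n) \<longlonglongrightarrow> \<eta> * 0"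
    by (intro tendsto_intros LIMSEQ_realpow_zero) auto
  then have "eventually (\<lambda>n. \<eta> * (1 / 2) ^ n < tau_eta \<eta> \<omega>) sequentially"
    using order_tendstoD(2) tau_eta_pos[OF assms, of \<omega>] by (metis mult_zero_right)
  then obtain n where "\<eta> * (1 / 2) ^ n < tau_eta \<eta> \<omega>" by (auto simp: eventually_sequentially)
  then have "\<eta> / 2 ^ n < tau_eta \<eta> \<omega>" by (simp add: power_one_over field_simps)
  then show ?thesis unfolding level_def by (rule LeastI)
qed

lemma level_eq_iff:
  assumes "0 < \<eta>"
  shows "level \<eta> \<omega> = n \<longleftrightarrow> \<eta> / 2 ^ n < tau_eta \<eta> \<omega> \<and> (\<forall>m<n. tau_eta \<eta> \<omega> \<le> \<eta> / 2 ^ m)"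
proof
  assume "level \<eta> \<omega> = n"
  then show "\<eta> / 2 ^ n < tau_eta \<eta> \<omega> \<and> (\<forall>m<n. tau_eta \<eta> \<omega> \<le> \<eta> / 2 ^ m)"
    using level_less[OF assms, of \<omega>] not_less_Least[of _ "\<lambda>n. \<eta> / 2 ^ n < tau_eta \<eta> \<omega>"]
    unfolding level_def by (auto simp: not_less)
next
  assume "\<eta> / 2 ^ n < tau_eta \<eta> \<omega> \<and> (\<forall>m<n. tau_eta \<eta> \<omega> \<le> \<eta> / 2 ^ m)"
  then show "level \<eta> \<omega> = n"
    unfolding level_def by (intro Least_equality) (auto simp: not_less[symmetric] intro: ccontr)
qed

text \<open>The level alone involves comparisons with \<open>\<eta> / 2 ^ m\<close> that may lie
  beyond \<open>t\<close>. Once \<open>tau_eta \<le> t\<close> is part of the event, they may be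
  capped at \<open>t\<close>; and the event is empty unless \<open>\<eta> / 2 ^ n\<close> is itself
  below \<open>t\<close>.\<close>

lemma pred_level_eq:
  assumes "0 < \<eta>" "0 \<le> t"
  shows "Measurable.pred (raw_filtration (ennreal t)) (\<lambda>\<omega>. level \<eta> \<omega> = n \<and> tau_eta \<eta> \<omega> \<le> t)"
proof (cases "\<eta> / 2 ^ n \<le> t")
  case True
  have eq: "(level \<eta> \<omega> = n \<and> tau_eta \<eta> \<omega> \<le> t) \<longleftrightarrow>
      \<eta> / 2 ^ n < tau_eta \<eta> \<omega> \<and> (\<forall>m\<in>{..<n}. tau_eta \<eta> \<omega> \<le> min t (\<eta> / 2 ^ m)) \<and> tau_eta \<eta> \<omega> \<le> t" for \<omega>
    using level_eq_iff[OF assms(1), of \<omega> n] by auto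
  have [measurable]: "Measurable.pred (raw_filtration (ennreal t)) (\<lambda>\<omega>. \<eta> / 2 ^ n < tau_eta \<eta> \<omega>)"
    "Measurable.pred (raw_filtration (ennreal t)) (\<lambda>\<omega>. tau_eta \<eta> \<omega> \<le> t)"
        by (rule pred_tau_eta_le; use assms True in auto)+
  have min: "Measurable.pred (raw_filtration (ennreal t)) (\<lambda>\<omega>. tau_eta \<eta> \<omega> \<le> min t (\<eta> / 2 ^ m))" for m
    by (rule pred_tau_eta_le) (use assms in auto)
  have [measurable]: "Measurable.pred (raw_filtration (ennreal t)) (\<lambda>\<omega>. \<forall>m\<in>{..<n}. tau_eta \<eta> \<omega> \<le> min t (\<eta> / 2 ^ m))"
    by (rule pred_countable_Ball[OF countable_finite[OF finite_lessThan] min])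
  show ?thesis unfolding eq by measurable
next
  case False
  then have "\<not> (level \<eta> \<omega> = n \<and> tau_eta \<eta> \<omega> \<le> t)" for \<omega>
    using level_less[OF assms(1), of \<omega>] by auto
  then have "(\<lambda>\<omega>. level \<eta> \<omega> = n \<and> tau_eta \<eta> \<omega> \<le> t) = (\<lambda>\<omega>. False)"
    by (intro ext) blast
  then show ?thesis by simp
qed

text \<open>The first conjunct keeps stopping after the exit and at the same time makes the level,
  and with it the coefficient, known at time \<open>t\<close>. The second is a quantile condition on
  the coefficient.\<close>

definition stop_by :: "real \<Rightarrow> (c0path \<Rightarrow> real measure) \<Rightarrow> c0path \<Rightarrow> real \<Rightarrow> bool" where
  "stop_by \<eta> \<kappa> \<omega> t \<longleftrightarrow> tau_eta \<eta> \<omega> \<le> t \<and>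
     alive_cdf \<eta> (\<eta> / 2 ^ level \<eta> \<omega>) \<omega> \<le> alive_mass \<eta> \<kappa> (\<eta> / 2 ^ level \<eta> \<omega>) \<omega> t"

text \<open>If the mass never reaches the threshold, the infimum is over the empty set and equals
  \<open>\<top>\<close>.\<close>

definition derandomized_time :: "real \<Rightarrow> (c0path \<Rightarrow> real measure) \<Rightarrow> c0path \<Rightarrow> ennreal" where
  "derandomized_time \<eta> \<kappa> \<omega> = (INF t\<in>{t. stop_by \<eta> \<kappa> \<omega> t}. ennreal t)"

text \<open>Splitting over the countably many levels replaces the random time \<open>s\<close> by a
  constant; only levels with \<open>\<eta> / 2 ^ n \<le> t\<close> contribute, and those are covered
  by \<open>measurable_alive_raw\<close>.\<close>

lemma pred_stop_by:
  assumes "0 < \<eta>" "0 \<le> t"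
    and \<kappa>: "(\<lambda>\<omega>. emeasure (\<kappa> \<omega>) {0..t}) \<in> borel_measurable (raw_filtration (ennreal t))"
  shows "Measurable.pred (raw_filtration (ennreal t)) (\<lambda>\<omega>. stop_by \<eta> \<kappa> \<omega> t)"
proof -
  have "stop_by \<eta> \<kappa> \<omega> t \<longleftrightarrow> (\<exists>n. (level \<eta> \<omega> = n \<and> tau_eta \<eta> \<omega> \<le> t) \<and>
      alive_cdf \<eta> (\<eta> / 2 ^ n) \<omega> \<le> alive_mass \<eta> \<kappa> (\<eta> / 2 ^ n) \<omega> t)" for \<omega>
    by (auto simp: stop_by_def)
  moreover have "Measurable.pred (raw_filtration (ennreal t)) (\<lambda>\<omega>. (level \<eta> \<omega> = n \<and> tau_eta \<eta> \<omega> \<le> t) \<and>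
      alive_cdf \<eta> (\<eta> / 2 ^ n) \<omega> \<le> alive_mass \<eta> \<kappa> (\<eta> / 2 ^ n) \<omega> t)" for n
  proof (cases "\<eta> / 2 ^ n \<le> t")
    case True
    have s: "0 < \<eta> / 2 ^ n" using assms(1) by simp
    note [measurable] = measurable_alive_raw[OF assms(1) s True, where \<kappa>=\<kappa>, OF \<kappa>]
    have "Measurable.pred (raw_filtration (ennreal t)) (\<lambda>\<omega>.
        alive_cdf \<eta> (\<eta> / 2 ^ n) \<omega> \<le> alive_mass \<eta> \<kappa> (\<eta> / 2 ^ n) \<omega> t)"
      by measurable
    with pred_level_eq[OF assms(1,2)] show ?thesis by (rule pred_intros_logic)
  next
    case False
    then have "\<not> (level \<eta> \<omega> = n \<and> tau_eta \<eta> \<omega> \<le> t)" for \<omega>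
      using level_less[OF assms(1), of \<omega>] by auto
    then have "(\<lambda>\<omega>. (level \<eta> \<omega> = n \<and> tau_eta \<eta> \<omega> \<le> t) \<and>
        alive_cdf \<eta> (\<eta> / 2 ^ n) \<omega> \<le> alive_mass \<eta> \<kappa> (\<eta> / 2 ^ n) \<omega> t) = (\<lambda>\<omega>. False)"
      by (intro ext) blast
    then show ?thesis by simp
  qed
  ultimately show ?thesis by (simp only:) (rule pred_intros_countable)
qed

lemma atLeastAtMost_Rplus [simp]: "{0..t} \<in> sets Rplus_borel"
  by (auto simp: Rplus_borel_def sets_restrict_space image_iff intro!: bexI[of _ "{0..t}"])

lemma alive_mass_mono:
  assumes "\<And>\<omega>. sets (\<kappa> \<omega>) = sets Rplus_borel" "t \<le> u"
  shows "alive_mass \<eta> \<kappa> s \<omega> t \<le> alive_mass \<eta> \<kappa> s \<omega> u"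
  unfolding alive_mass_def
  using assms by (intro nn_integral_mono mult_left_mono emeasure_mono) auto

lemma measurable_alive_section:
  assumes "0 < \<eta>"
  shows "alive \<eta> s \<omega> \<in> sets borel"
proof -
  note [measurable] = measurable_tau_eta[OF assms]
  have "Measurable.pred borel (\<lambda>x. s < tau_eta \<eta> (case (\<omega>, x) of (\<omega>, x) \<Rightarrow> resample s \<omega> x))"
    by measurable
  then show ?thesis by (simp add: alive_def pred_def)
qed

lemma measurable_resample_section [measurable]: "(\<lambda>x. resample s \<omega> x) \<in> borel \<rightarrow>\<^sub>M borel"
  using measurable_compose[OF measurable_Pair1' measurable_resample, of \<omega> s] by simp

text \<open>Continuity from above, used twice: for each kernel along intervals shrinking to
  \<open>[0,t]\<close>, and for the integral over the coefficient, whose integrands are bounded by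
  1.\<close>

lemma alive_mass_right_continuous:
  assumes "0 < \<eta>" "0 < s" "0 \<le> t"
    and \<kappa>: "\<And>\<omega>. sets (\<kappa> \<omega>) = sets Rplus_borel" "\<And>\<omega>. emeasure (\<kappa> \<omega>) (space (\<kappa> \<omega>)) \<le> 1"
      "\<And>t. 0 \<le> t \<Longrightarrow> (\<lambda>\<omega>. emeasure (\<kappa> \<omega>) {0..t}) \<in> borel_measurable borel"
    and le: "\<And>u. t < u \<Longrightarrow> y \<le> alive_mass \<eta> \<kappa> s \<omega> u"
  shows "y \<le> alive_mass \<eta> \<kappa> s \<omega> t"
proof -
  interpret prob_space "mid_law s" by (rule prob_space_mid_law[OF assms(2)])
  define v where "v n = t + 1 / real (Suc n)" for n
  have v: "0 \<le> v n" "t < v n" for n using assms(3) unfolding v_def by auto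
  have v_mono: "v n \<le> v m" if "m \<le> n" for m n
    using that unfolding v_def by (simp add: frac_le)
  have v_lim: "v \<longlonglongrightarrow> t"
    unfolding v_def using tendsto_add[OF tendsto_const[of t] LIMSEQ_Suc[OF lim_1_over_n]] by simp
  have INT: "(\<Inter>n. {0..v n}) = {0..t}"
  proof (intro equalityI subsetI)
    fix u assume "u \<in> (\<Inter>n. {0..v n})"
    then have u: "0 \<le> u" "\<And>n. u \<le> v n" by auto
    then show "u \<in> {0..t}" using LIMSEQ_le_const[OF v_lim, of u] by auto
  qed (use less_imp_le[OF v(2)] in \<open>auto intro: order.trans\<close>)
  have fin: "emeasure (\<kappa> \<omega>') A < \<top>" for \<omega>' A
    using order.trans[OF emeasure_space \<kappa>(2)] ennreal_one_less_top by (rule le_less_trans)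
  let ?f = "\<lambda>n x. indicator (alive \<eta> s \<omega>) x * emeasure (\<kappa> (resample s \<omega> x)) {0..v n}"
  note [measurable] = measurable_alive_section[OF assms(1)] \<kappa>(3)[OF v(1)]
  have "y \<le> (INF n. integral\<^sup>N (mid_law s) (?f n))"
    using le[OF v(2)] unfolding alive_mass_def by (rule INF_greatest)
  also have "\<dots> = (\<integral>\<^sup>+x. (INF n. ?f n x) \<partial>mid_law s)"
  proof (rule nn_integral_monotone_convergence_INF_decseq[symmetric])
    show "decseq ?f"
    proof (intro decseq_SucI le_funI mult_left_mono emeasure_mono)
      show "{0..v (Suc n)} \<subseteq> {0..v n}" for n using v_mono[of n "Suc n"] by auto
    qed (simp_all add: \<kappa>(1))
    show "?f n \<in> borel_measurable (mid_law s)" for n by measurable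
    have "(\<integral>\<^sup>+x. ?f 0 x \<partial>mid_law s) \<le> (\<integral>\<^sup>+x. 1 \<partial>mid_law s)"
    proof (rule nn_integral_mono)
      fix x
      have "emeasure (\<kappa> (resample s \<omega> x)) {0..v 0} \<le> 1"
        using emeasure_space \<kappa>(2) by (rule order.trans)
      then show "?f 0 x \<le> 1" by (auto simp: indicator_def)
    qed
    then show "(\<integral>\<^sup>+x. ?f 0 x \<partial>mid_law s) < \<infinity>" 
      using emeasure_space_1 by (auto intro: le_less_trans)
  qed
  also have "\<dots> = alive_mass \<eta> \<kappa> s \<omega> t"
    unfolding alive_mass_def
  proof (rule nn_integral_cong)
    fix x
    have "(INF n. emeasure (\<kappa> (resample s \<omega> x)) {0..v n}) = emeasure (\<kappa> (resample s \<omega> x)) {0..t}"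
      unfolding INT[symmetric] using v_mono \<kappa>(1) fin
      by (intro INF_emeasure_decseq) (auto simp: decseq_def less_top[symmetric])
    then show "(INF n. ?f n x) = indicator (alive \<eta> s \<omega>) x * emeasure (\<kappa> (resample s \<omega> x)) {0..t}"
      by (cases "x \<in> alive \<eta> s \<omega>") auto
  qed
  finally show ?thesis .
qed

lemma stop_by_mono:
  assumes "\<And>\<omega>. sets (\<kappa> \<omega>) = sets Rplus_borel" "t \<le> u" "stop_by \<eta> \<kappa> \<omega> t"
  shows "stop_by \<eta> \<kappa> \<omega> u"
  using assms(2,3) alive_mass_mono[where \<kappa>=\<kappa>, OF assms(1,2)] unfolding stop_by_def
  by (auto intro: order.trans)

lemma derandomized_time_le_iff:
  assumes "0 < \<eta>" "0 \<le> t"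
    and \<kappa>: "\<And>\<omega>. sets (\<kappa> \<omega>) = sets Rplus_borel" "\<And>\<omega>. emeasure (\<kappa> \<omega>) (space (\<kappa> \<omega>)) \<le> 1"
      "\<And>t. 0 \<le> t \<Longrightarrow> (\<lambda>\<omega>. emeasure (\<kappa> \<omega>) {0..t}) \<in> borel_measurable borel"
  shows "derandomized_time \<eta> \<kappa> \<omega> \<le> ennreal t \<longleftrightarrow> stop_by \<eta> \<kappa> \<omega> t"
proof
  assume "stop_by \<eta> \<kappa> \<omega> t"
  then show "derandomized_time \<eta> \<kappa> \<omega> \<le> ennreal t"
    unfolding derandomized_time_def by (intro INF_lower) auto
next
  assume le: "derandomized_time \<eta> \<kappa> \<omega> \<le> ennreal t"
  have stop: "stop_by \<eta> \<kappa> \<omega> v" if "t < v" for v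
  proof -
    have "derandomized_time \<eta> \<kappa> \<omega> < ennreal v"
      using le that assms(2) by (auto intro: le_less_trans simp: ennreal_less_iff)
    then obtain u where u: "stop_by \<eta> \<kappa> \<omega> u" "ennreal u < ennreal v"
      unfolding derandomized_time_def by (auto simp: INF_less_iff)
    have "0 \<le> u" using u(1) tau_eta_mem(1)[OF assms(1), of \<omega>] unfolding stop_by_def by simp
    then have "u \<le> v" using u(2) by (simp add: ennreal_less_iff)
    then show ?thesis by (rule stop_by_mono[OF \<kappa>(1) _ u(1)])
  qed
  have "tau_eta \<eta> \<omega> \<le> t"
    by (rule dense_ge) (use stop in \<open>simp add: stop_by_def\<close>)
  moreover have "alive_cdf \<eta> (\<eta> / 2 ^ level \<eta> \<omega>) \<omega> \<le> alive_mass \<eta> \<kappa> (\<eta> / 2 ^ level \<eta> \<omega>) \<omega> t"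
    using stop assms(1) unfolding stop_by_def
    by (intro alive_mass_right_continuous[OF assms(1) _ assms(2), where \<kappa>=\<kappa>, OF _ \<kappa>]) auto
  ultimately show "stop_by \<eta> \<kappa> \<omega> t" unfolding stop_by_def by simp
qed

lemma tau_eta_le_derandomized_time:
  assumes "0 < \<eta>"
  shows "ennreal (tau_eta \<eta> \<omega>) \<le> derandomized_time \<eta> \<kappa> \<omega>"
  unfolding derandomized_time_def stop_by_def by (rule INF_greatest) (auto intro: ennreal_leI)

text \<open>Alive coefficients alter the path only before \<open>s\<close>, hence before the exit,
  so the class of the path is constant on \<open>alive\<close>.\<close>

lemma post_equiv_resample:
  assumes "0 < \<eta>" "0 < s" "x \<in> alive \<eta> s \<omega>" "y \<in> alive \<eta> s \<omega>"
  shows "post_equiv \<eta> (resample s \<omega> x) (resample s \<omega> y)"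
proof -
  have *: "s < tau_eta \<eta> (resample s \<omega> x)" "s < tau_eta \<eta> (resample s \<omega> y)"
    using assms by (auto simp: alive_def)
  have "tau_eta \<eta> (resample s \<omega> x) = tau_eta \<eta> (resample s \<omega> y)"
    using assms(1,2) * by (intro tau_eta_eqI[of \<eta> s]) (auto simp: path_at_resample_ge)
  then show ?thesis
    using * assms(2) by (auto simp: post_equiv_def path_at_resample_ge)
qed

text \<open>Resampling fixes the alive set and moves only the evaluation point, while
  \<open>alive_mass\<close> does not move at all; \<open>stop_by\<close> thus becomes a threshold
  condition on \<open>x\<close>.\<close>

lemma alive_cdf_resample:
  assumes "0 < s"
  shows "alive_cdf \<eta> s (resample s \<omega> x) = emeasure (mid_law s) (alive \<eta> s \<omega> \<inter> {..x})"
  using assms by (simp add: alive_cdf_def alive_def resample_resample mid_resample)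

lemma alive_mass_resample:
  "0 < s \<Longrightarrow> alive_mass \<eta> \<kappa> s (resample s \<omega> x) t = alive_mass \<eta> \<kappa> s \<omega> t"
  by (simp add: alive_mass_def alive_def resample_resample)

text \<open>The integral transform for the normal law restricted to \<open>alive\<close>, which has
  no atoms because it has a density.\<close>

lemma emeasure_alive_cdf_le:
  assumes "0 < \<eta>" "0 < s" "v \<le> emeasure (mid_law s) (alive \<eta> s \<omega>)"
  shows "emeasure (mid_law s) {x \<in> alive \<eta> s \<omega>. emeasure (mid_law s) (alive \<eta> s \<omega> \<inter> {..x}) \<le> v} = v"
    and measurable_alive_cdf_le: "{x \<in> alive \<eta> s \<omega>. emeasure (mid_law s) (alive \<eta> s \<omega> \<inter> {..x}) \<le> v} \<in> sets borel"
proof -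
  interpret prob_space "mid_law s" by (rule prob_space_mid_law[OF assms(2)])
  let ?M = "density (mid_law s) (indicator (alive \<eta> s \<omega>))"
  note [measurable] = measurable_alive_section[OF assms(1)]
  have em: "emeasure ?M A = emeasure (mid_law s) (alive \<eta> s \<omega> \<inter> A)" if "A \<in> sets borel" for A
    using that by (intro emeasure_restricted) auto
  have "emeasure ?M {x. emeasure ?M {..x} \<le> v} = v"
  proof (rule emeasure_cdf_le)
    show "finite_measure ?M" by (rule finite_measureI) (simp add: em)
    have "emeasure (mid_law s) {x} = 0" for x
      unfolding mid_law_def by (subst emeasure_density) (auto simp: nn_integral_indicator_singleton)
    then show "emeasure ?M {x} = 0" for x
      using emeasure_mono[of "alive \<eta> s \<omega> \<inter> {x}" "{x}" "mid_law s"] by (simp add: em)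
  qed (use assms(3) in \<open>simp_all add: em\<close>)
  \<comment> \<open>The restricted distribution function is measurable because it is
    monotone.\<close>
  moreover have "mono (\<lambda>x. prob (alive \<eta> s \<omega> \<inter> {..x}))"
    by (intro monoI finite_measure_mono) auto
  then have [measurable]: "(\<lambda>x. emeasure (mid_law s) (alive \<eta> s \<omega> \<inter> {..x})) \<in> borel_measurable borel"
    unfolding emeasure_eq_measure by (intro measurable_compose[OF borel_measurable_mono measurable_ennreal])
  ultimately show "emeasure (mid_law s) {x \<in> alive \<eta> s \<omega>. emeasure (mid_law s) (alive \<eta> s \<omega> \<inter> {..x}) \<le> v} = v"
    by (simp add: em Int_def)
  have "{x \<in> space borel. x \<in> alive \<eta> s \<omega> \<and> emeasure (mid_law s) (alive \<eta> s \<omega> \<inter> {..x}) \<le> v} \<in> sets borel"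
    by measurable
  then show "{x \<in> alive \<eta> s \<omega>. emeasure (mid_law s) (alive \<eta> s \<omega> \<inter> {..x}) \<le> v} \<in> sets borel"
    by simp
qed

lemma pred_level_eq_borel:
  "0 < \<eta> \<Longrightarrow> 0 \<le> t \<Longrightarrow> Measurable.pred borel (\<lambda>\<omega>. level \<eta> \<omega> = n \<and> tau_eta \<eta> \<omega> \<le> t)"
  by (rule measurable_raw_borel[OF pred_level_eq])

lemma suminf_indicator_level:
  "(\<Sum>n. indicator {\<omega>. level \<eta> \<omega> = n \<and> P \<omega>} \<omega> * (f n :: ennreal)) = indicator {\<omega>. P \<omega>} \<omega> * f (level \<eta> \<omega>)"
  by (subst suminf_finite[of "{level \<eta> \<omega>}"]) (auto simp: indicator_def)

text \<open>The core of the construction. On level \<open>n\<close> both integrals are averaged over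
  the coefficient with \<open>s = \<eta> / 2 ^ n\<close>. For a fixed remainder of the path, the
  coefficients at which stopping occurs have mass \<open>alive_mass\<close> by the integral
  transform, and this is by definition the average of the kernel.\<close>

lemma emeasure_stop_by:
  assumes W: "wiener_measure W" and \<eta>: "0 < \<eta>" and t: "0 \<le> t" and C: "C \<in> sets (post_algebra \<eta>)"
    and \<kappa>: "\<And>\<omega>. emeasure (\<kappa> \<omega>) (space (\<kappa> \<omega>)) \<le> 1"
      "(\<lambda>\<omega>. emeasure (\<kappa> \<omega>) {0..t}) \<in> borel_measurable (raw_filtration (ennreal t))"
  shows "emeasure W {\<omega> \<in> C. stop_by \<eta> \<kappa> \<omega> t} =
    (\<integral>\<^sup>+\<omega>. indicator {\<omega> \<in> C. tau_eta \<eta> \<omega> \<le> t} \<omega> * emeasure (\<kappa> \<omega>) {0..t} \<partial>W)"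
proof -
  have [measurable_cong]: "sets W = sets borel" using W by (simp add: wiener_measure_def)
  have C_borel [measurable]: "C \<in> sets borel" and C_inv: "\<And>\<omega> \<omega>'. post_equiv \<eta> \<omega> \<omega>' \<Longrightarrow> \<omega> \<in> C \<longleftrightarrow> \<omega>' \<in> C"
    using C by (auto simp: sets_post_algebra)
  note [measurable] = pred_level_eq_borel[OF \<eta> t] measurable_raw_borel[OF \<kappa>(2)]
    measurable_raw_borel[OF pred_stop_by[where \<kappa>=\<kappa>, OF \<eta> t \<kappa>(2)]]
  define H where "H n = (indicator {\<omega>. level \<eta> \<omega> = n \<and> (tau_eta \<eta> \<omega> \<le> t \<and> \<omega> \<in> C)} :: c0path \<Rightarrow> ennreal)" for n
  have H_meas [measurable]: "H n \<in> borel_measurable borel" for n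
  proof -
    have "{\<omega>. level \<eta> \<omega> = n \<and> tau_eta \<eta> \<omega> \<le> t} \<inter> C \<in> sets borel"
      using pred_level_eq_borel[OF \<eta> t, of n] C_borel unfolding pred_def by (intro sets.Int) simp_all
    also have "{\<omega>. level \<eta> \<omega> = n \<and> tau_eta \<eta> \<omega> \<le> t} \<inter> C = {\<omega>. level \<eta> \<omega> = n \<and> (tau_eta \<eta> \<omega> \<le> t \<and> \<omega> \<in> C)}"
      by auto
    finally show ?thesis unfolding H_def by (rule borel_measurable_indicator)
  qed
  have level: "(\<integral>\<^sup>+\<omega>. H n \<omega> * indicator {\<omega>. stop_by \<eta> \<kappa> \<omega> t} \<omega> \<partial>W) = (\<integral>\<^sup>+\<omega>. H n \<omega> * emeasure (\<kappa> \<omega>) {0..t} \<partial>W)" for n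
  proof -
    let ?s = "\<eta> / 2 ^ n"
    have s: "0 < ?s" using \<eta> by simp
    interpret mid: prob_space "mid_law ?s" by (rule prob_space_mid_law[OF s])
    have inner: "(\<integral>\<^sup>+x. H n (resample ?s \<omega> x) * indicator {\<omega>. stop_by \<eta> \<kappa> \<omega> t} (resample ?s \<omega> x) \<partial>mid_law ?s) =
      (\<integral>\<^sup>+x. H n (resample ?s \<omega> x) * emeasure (\<kappa> (resample ?s \<omega> x)) {0..t} \<partial>mid_law ?s)" for \<omega>
    proof (cases "\<exists>x. H n (resample ?s \<omega> x) \<noteq> 0")
      case True
      let ?A = "alive \<eta> ?s \<omega>" and ?R = "resample ?s \<omega>"
      obtain x0 where x0: "level \<eta> (?R x0) = n" "tau_eta \<eta> (?R x0) \<le> t" "?R x0 \<in> C"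
        using True by (auto simp: H_def indicator_def split: if_splits)
      then have "x0 \<in> ?A" using level_less[OF \<eta>, of "?R x0"] by (simp add: alive_def)
      \<comment> \<open>One witness \<open>x0\<close> settles all alive coefficients, since exit
        time, level and membership in \<open>C\<close> are invariant under
        \<open>post_equiv\<close>. Conversely, level \<open>n\<close> places the exit after
        \<open>s\<close>, so the coefficient is alive.\<close>
      have R: "level \<eta> (?R x) = n \<and> tau_eta \<eta> (?R x) \<le> t \<and> ?R x \<in> C \<longleftrightarrow> x \<in> ?A" for x
      proof
        assume "x \<in> ?A"
        then have *: "post_equiv \<eta> (?R x) (?R x0)"
          using \<open>x0 \<in> ?A\<close> by (intro post_equiv_resample \<eta> s)
        then have "tau_eta \<eta> (?R x) = tau_eta \<eta> (?R x0)" by (simp add: post_equiv_def)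
        then show "level \<eta> (?R x) = n \<and> tau_eta \<eta> (?R x) \<le> t \<and> ?R x \<in> C"
          using x0 C_inv[OF *] by (simp add: level_def)
      qed (use level_less[OF \<eta>, of "?R x"] in \<open>auto simp: alive_def\<close>)
      have H: "H n (?R x) = indicator ?A x" for x
        using R[of x] by (simp add: H_def indicator_def)
      let ?m = "alive_mass \<eta> \<kappa> ?s \<omega> t"
      \<comment> \<open>The integral transform needs a threshold in the range of the distribution
        function; kernels of mass at most 1 provide it.\<close>
      have m_le: "?m \<le> emeasure (mid_law ?s) ?A"
      proof -
        have "?m \<le> (\<integral>\<^sup>+x. indicator ?A x \<partial>mid_law ?s)"
          unfolding alive_mass_def
        proof (rule nn_integral_mono)
          fix x
          have "emeasure (\<kappa> (?R x)) {0..t} \<le> 1" using emeasure_space \<kappa>(1) by (rule order.trans)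
          then show "indicator ?A x * emeasure (\<kappa> (?R x)) {0..t} \<le> indicator ?A x"
            by (simp add: indicator_def)
        qed
        then show ?thesis using measurable_alive_section[OF \<eta>] by simp
      qed
      have "(\<integral>\<^sup>+x. H n (?R x) * indicator {\<omega>. stop_by \<eta> \<kappa> \<omega> t} (?R x) \<partial>mid_law ?s) =
        (\<integral>\<^sup>+x. indicator {x \<in> ?A. emeasure (mid_law ?s) (?A \<inter> {..x}) \<le> ?m} x \<partial>mid_law ?s)"
      proof (rule nn_integral_cong)
        fix x
        have "stop_by \<eta> \<kappa> (?R x) t \<longleftrightarrow> emeasure (mid_law ?s) (?A \<inter> {..x}) \<le> ?m" if "x \<in> ?A"
          using R[of x] that s by (simp add: stop_by_def alive_cdf_resample alive_mass_resample)
        then show "H n (?R x) * indicator {\<omega>. stop_by \<eta> \<kappa> \<omega> t} (?R x) =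
          indicator {x \<in> ?A. emeasure (mid_law ?s) (?A \<inter> {..x}) \<le> ?m} x"
          by (auto simp: H indicator_def)
      qed
      also have "\<dots> = ?m"
        using measurable_alive_cdf_le[OF \<eta> s m_le] by (simp add: emeasure_alive_cdf_le[OF \<eta> s m_le])
      also have "\<dots> = (\<integral>\<^sup>+x. H n (?R x) * emeasure (\<kappa> (?R x)) {0..t} \<partial>mid_law ?s)"
        unfolding alive_mass_def H ..
      finally show ?thesis .
    qed simp
    have "(\<integral>\<^sup>+\<omega>. H n \<omega> * indicator {\<omega>. stop_by \<eta> \<kappa> \<omega> t} \<omega> \<partial>W) =
      (\<integral>\<^sup>+\<omega>. (\<integral>\<^sup>+x. H n (resample ?s \<omega> x) * indicator {\<omega>. stop_by \<eta> \<kappa> \<omega> t} (resample ?s \<omega> x) \<partial>mid_law ?s) \<partial>W)"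
      by (rule nn_integral_resample[OF W s]) measurable
    also have "\<dots> = (\<integral>\<^sup>+\<omega>. (\<integral>\<^sup>+x. H n (resample ?s \<omega> x) * emeasure (\<kappa> (resample ?s \<omega> x)) {0..t} \<partial>mid_law ?s) \<partial>W)"
      by (simp only: inner)
    also have "\<dots> = (\<integral>\<^sup>+\<omega>. H n \<omega> * emeasure (\<kappa> \<omega>) {0..t} \<partial>W)"
      by (rule nn_integral_resample[OF W s, symmetric]) measurable
    finally show ?thesis .
  qed
  \<comment> \<open>Each path has exactly one level, so the level-wise integrals add up.\<close>
  have sum: "(\<integral>\<^sup>+\<omega>. indicator {\<omega> \<in> C. tau_eta \<eta> \<omega> \<le> t} \<omega> * g \<omega> \<partial>W) = (\<Sum>n. \<integral>\<^sup>+\<omega>. H n \<omega> * g \<omega> \<partial>W)"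
    if [measurable]: "g \<in> borel_measurable borel" for g :: "c0path \<Rightarrow> ennreal"
  proof -
    have "(\<integral>\<^sup>+\<omega>. indicator {\<omega> \<in> C. tau_eta \<eta> \<omega> \<le> t} \<omega> * g \<omega> \<partial>W) = (\<integral>\<^sup>+\<omega>. (\<Sum>n. H n \<omega> * g \<omega>) \<partial>W)"
      unfolding H_def suminf_indicator_level by (auto simp: indicator_def intro!: nn_integral_cong)
    also have "\<dots> = (\<Sum>n. \<integral>\<^sup>+\<omega>. H n \<omega> * g \<omega> \<partial>W)"
      by (rule nn_integral_suminf) measurable
    finally show ?thesis .
  qed
  have "emeasure W {\<omega> \<in> C. stop_by \<eta> \<kappa> \<omega> t} = (\<integral>\<^sup>+\<omega>. indicator {\<omega> \<in> C. stop_by \<eta> \<kappa> \<omega> t} \<omega> \<partial>W)"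
  proof (rule nn_integral_indicator[symmetric])
    have "{\<omega> \<in> space borel. \<omega> \<in> C \<and> stop_by \<eta> \<kappa> \<omega> t} \<in> sets borel" by measurable
    then show "{\<omega> \<in> C. stop_by \<eta> \<kappa> \<omega> t} \<in> sets W" using W by (simp add: wiener_measure_def)
  qed
  also have "\<dots> = (\<integral>\<^sup>+\<omega>. indicator {\<omega> \<in> C. tau_eta \<eta> \<omega> \<le> t} \<omega> * indicator {\<omega>. stop_by \<eta> \<kappa> \<omega> t} \<omega> \<partial>W)"
    by (intro nn_integral_cong) (auto simp: indicator_def stop_by_def)
  also have "\<dots> = (\<Sum>n. \<integral>\<^sup>+\<omega>. H n \<omega> * emeasure (\<kappa> \<omega>) {0..t} \<partial>W)"
    unfolding level[symmetric] by (rule sum) measurable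
  also have "\<dots> = (\<integral>\<^sup>+\<omega>. indicator {\<omega> \<in> C. tau_eta \<eta> \<omega> \<le> t} \<omega> * emeasure (\<kappa> \<omega>) {0..t} \<partial>W)"
    by (rule sum[symmetric]) measurable
  finally show ?thesis .
qed

section \<open>Uniqueness of laws from rectangles\<close>

lemma sets_Rplus_borel: "sets Rplus_borel = sigma_sets {0..} (range (\<lambda>t. {0..t}))"
proof -
  have "sets Rplus_borel = (\<inter>) {0..} ` sigma_sets UNIV (range atMost)"
    unfolding Rplus_borel_def sets_restrict_space by (simp add: borel_eq_atMost[where 'a=real] sets_measure_of_conv)
  also have "\<dots> = sigma_sets {0..} ((\<inter>) {0..} ` range atMost)"
    by (rule sigma_sets_Int)
       (use atLeast_borel[of "0::real"] in \<open>simp_all add: borel_eq_atMost[where 'a=real] sets_measure_of_conv\<close>)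
  also have "(\<inter>) {0..} ` range atMost = range (\<lambda>t::real. {0..t})"
    by (auto simp: image_image atLeastAtMost_def)
  finally show ?thesis .
qed

lemma space_Rplus_borel [simp]: "space Rplus_borel = {0..}"
  by (simp add: Rplus_borel_def space_restrict_space)

text \<open>Rectangles with a time interval starting at 0 are stable under intersection and
  generate; they are the sets whose masses \<open>emeasure_stop_by\<close> provides.\<close>

lemma measure_eqI_post_Rplus:
  assumes "finite_measure M" "sets M = sets (post_algebra \<eta> \<Otimes>\<^sub>M Rplus_borel)"
    "sets N = sets (post_algebra \<eta> \<Otimes>\<^sub>M Rplus_borel)"
    and eq: "\<And>C t. C \<in> sets (post_algebra \<eta>) \<Longrightarrow> 0 \<le> t \<Longrightarrow> emeasure M (C \<times> {0..t}) = emeasure N (C \<times> {0..t})"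
  shows "M = N"
proof (rule measure_eqI_generator_eq)
  let ?E = "{C \<times> I | C I. C \<in> sets (post_algebra \<eta>) \<and> I \<in> range (\<lambda>t::real. {0..t})}"
  show "Int_stable ?E"
  proof (rule Int_stableI)
    fix a b assume "a \<in> ?E" "b \<in> ?E"
    then obtain C t D u where "a = C \<times> {0..t}" "b = D \<times> {0..u}" "C \<in> sets (post_algebra \<eta>)" "D \<in> sets (post_algebra \<eta>)"
      by auto
    then show "a \<inter> b \<in> ?E"
      by (intro CollectI exI[of _ "C \<inter> D"] exI[of _ "{0..min t u}"]) auto
  qed
  show E_Pow: "?E \<subseteq> Pow (UNIV \<times> {0..})" by auto
  have cover: "(\<Union>n. {0..real n}) = {0..}"
    using real_arch_simple by auto
  have "sets (post_algebra \<eta> \<Otimes>\<^sub>M Rplus_borel) = sets (sigma (space (post_algebra \<eta>) \<times> space Rplus_borel) ?E)"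
  proof (rule sets_pair_eq[where Ca="{UNIV}" and Cb="range (\<lambda>n. {0..real n})"])
    show "sets (post_algebra \<eta>) = sigma_sets (space (post_algebra \<eta>)) (sets (post_algebra \<eta>))"
      by (rule sets.sigma_sets_eq[symmetric])
    show "sets Rplus_borel = sigma_sets (space Rplus_borel) (range (\<lambda>t. {0..t}))"
      by (simp add: sets_Rplus_borel)
    show "{UNIV} \<subseteq> sets (post_algebra \<eta>)" using sets.top[of "post_algebra \<eta>"] by simp
    show "\<Union> (range (\<lambda>n. {0..real n})) = space Rplus_borel" using cover by simp
  qed auto
  also have "\<dots> = sigma_sets (UNIV \<times> {0..}) ?E"
    using sets_measure_of[OF E_Pow] by simp
  finally show "sets M = sigma_sets (UNIV \<times> {0..}) ?E" "sets N = sigma_sets (UNIV \<times> {0..}) ?E"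
    using assms(2,3) by simp_all
  show "range (\<lambda>n. UNIV \<times> {0..real n}) \<subseteq> ?E"
    using sets.top[of "post_algebra \<eta>"] by auto
  show "(\<Union>n. UNIV \<times> {0..real n}) = UNIV \<times> {0..}" using cover by auto
  show "emeasure M (UNIV \<times> {0..real n}) \<noteq> \<infinity>" for n
    using finite_measure.emeasure_finite[OF assms(1)] by simp
  show "emeasure M X = emeasure N X" if XE: "X \<in> ?E" for X
  proof -
    obtain C t where "X = C \<times> {0..t}" "C \<in> sets (post_algebra \<eta>)" using XE by auto
    \<comment> \<open>For negative \<open>t\<close> the interval is empty and both masses
      vanish.\<close>
    then show ?thesis using eq[of C t] by (cases "0 \<le> t") auto
  qed
qed

subsection \<open>Equality of laws\<close>

text \<open>Joint continuity is used through sections only: continuity in the path, with invariance,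
  gives measurability for the saturated sets, and continuity in time gives the right limits. So the
  Borel sets of the product topology never have to be compared with the product
  sigma-algebra.\<close>

lemma measurable_Cb_eta:
  assumes "G \<in> Cb_eta \<eta>"
  shows "G \<in> borel_measurable (post_algebra \<eta> \<Otimes>\<^sub>M Rplus_borel)"
proof (rule measurable_pair_right_continuous)
  have cont: "continuous_on (UNIV \<times> {0..}) G" using assms by (simp add: Cb_eta_def)
  fix t :: real assume t: "0 \<le> t"
  have "continuous_on UNIV (G \<circ> (\<lambda>\<omega>. (\<omega>, t)))"
    by (intro continuous_on_compose continuous_intros continuous_on_subset[OF cont]) (use t in auto)
  then have "(\<lambda>\<omega>. G (\<omega>, t)) \<in> borel_measurable borel"
    by (intro borel_measurable_continuous_onI) (simp add: comp_def)
  then show "(\<lambda>\<omega>. G (\<omega>, t)) \<in> borel_measurable (post_algebra \<eta>)"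
    by (rule measurable_post_algebraI) (use assms t in \<open>auto simp: Cb_eta_def post_equiv_def\<close>)
  fix \<omega>
  have "continuous_on {0..} (G \<circ> (\<lambda>u. (\<omega>, u)))"
    by (intro continuous_on_compose continuous_intros continuous_on_subset[OF cont]) auto
  then have "((\<lambda>u. G (\<omega>, u)) \<longlongrightarrow> G (\<omega>, t)) (at t within {0..})"
    using t by (auto simp: continuous_on_def comp_def)
  then show "((\<lambda>u. G (\<omega>, u)) \<longlongrightarrow> G (\<omega>, t)) (at_right t)"
    by (rule tendsto_within_subset) (use t in auto)
qed

lemma tendsto_path_at_right:
  assumes "0 \<le> t"
  shows "(path_at \<omega> \<longlongrightarrow> path_at \<omega> t) (at_right t)"
proof (rule tendsto_within_subset)
  show "(path_at \<omega> \<longlongrightarrow> path_at \<omega> t) (at t within {0..})"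
    using continuous_on_path_at assms by (auto simp: continuous_on_def)
qed (use assms in auto)

lemma measurable_path_at_pair:
  "(\<lambda>(\<omega>, t). path_at \<omega> t) \<in> borel_measurable (borel \<Otimes>\<^sub>M Rplus_borel)"
  by (rule measurable_pair_right_continuous) (simp_all add: tendsto_path_at_right)

text \<open>Before the exit the coordinate process is not invariant under \<open>post_equiv\<close>,
  so it is cut off there. The cut function jumps at \<open>tau_eta\<close> but is right-continuous,
  and it agrees with the coordinate process wherever a time in \<open>RST_eta\<close> can
  stop.\<close>

lemma measurable_path_after_tau:
  assumes "0 < \<eta>"
  shows "(\<lambda>(\<omega>, t). if tau_eta \<eta> \<omega> \<le> t then path_at \<omega> t else 0)
    \<in> borel_measurable (post_algebra \<eta> \<Otimes>\<^sub>M Rplus_borel)"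
proof (rule measurable_pair_right_continuous)
  note [measurable] = measurable_tau_eta[OF assms]
  fix t :: real assume t: "0 \<le> t"
  show "(\<lambda>\<omega>. case (\<omega>, t) of (\<omega>, t) \<Rightarrow> if tau_eta \<eta> \<omega> \<le> t then path_at \<omega> t else 0) \<in> borel_measurable (post_algebra \<eta>)"
    by (rule measurable_post_algebraI) (auto simp: post_equiv_def)
  fix \<omega>
  show "((\<lambda>u. case (\<omega>, u) of (\<omega>, t) \<Rightarrow> if tau_eta \<eta> \<omega> \<le> t then path_at \<omega> t else 0) \<longlongrightarrow>
    (case (\<omega>, t) of (\<omega>, t) \<Rightarrow> if tau_eta \<eta> \<omega> \<le> t then path_at \<omega> t else 0)) (at_right t)"
  proof (cases "tau_eta \<eta> \<omega> \<le> t")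
    case True
    have "eventually (\<lambda>u. path_at \<omega> u = (if tau_eta \<eta> \<omega> \<le> u then path_at \<omega> u else 0)) (at_right t)"
      using True by (auto simp: eventually_at_filter intro!: always_eventually)
    from Lim_transform_eventually[OF tendsto_path_at_right[OF t] this] True show ?thesis by simp
  next
    case False
    then have "eventually (\<lambda>u. u < tau_eta \<eta> \<omega>) (at_right t)"
      by (intro order_tendstoD(2)[OF tendsto_ident_at]) simp
    then have "eventually (\<lambda>u. 0 = (if tau_eta \<eta> \<omega> \<le> u then path_at \<omega> u else 0)) (at_right t)"
      by eventually_elim simp
    from Lim_transform_eventually[OF tendsto_const this] False show ?thesis by simp
  qed
qed

text \<open>Transfers the support condition from the kernels to the joint law by evaluating the
  disintegration on the region after the exit.\<close>

lemma AE_tau_eta_le: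
  assumes "0 < \<eta>" and \<xi>: "disintegrates W \<xi> \<kappa>" "prob_space \<xi>" and W: "wiener_measure W"
    and AE: "AE \<omega> in W. emeasure (\<kappa> \<omega>) {tau_eta \<eta> \<omega>..} = 1"
  shows "AE p in \<xi>. tau_eta \<eta> (fst p) \<le> snd p"
proof -
  interpret \<xi>: prob_space \<xi> by fact
  interpret W: prob_space W using W by (simp add: wiener_measure_def)
  note [measurable] = measurable_tau_eta[OF assms(1)]
  have [measurable]: "snd \<in> borel_measurable ((borel :: c0path measure) \<Otimes>\<^sub>M Rplus_borel)"
    by (rule measurable_compose[OF measurable_snd]) (simp add: Rplus_borel_def measurable_restrict_space1)
  have sets: "sets \<xi> = sets (borel \<Otimes>\<^sub>M Rplus_borel)" using \<xi>(1) by (simp add: disintegrates_def)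
  note space = sets_eq_imp_space_eq[OF sets]
  let ?S = "{p \<in> space \<xi>. tau_eta \<eta> (fst p) \<le> snd p}"
  have S: "?S \<in> sets \<xi>" unfolding sets space by measurable
  have "emeasure \<xi> ?S = (\<integral>\<^sup>+\<omega>. emeasure (\<kappa> \<omega>) (Pair \<omega> -` ?S) \<partial>W)"
    using \<xi>(1) S by (simp add: disintegrates_def)
  also have "\<dots> = (\<integral>\<^sup>+\<omega>. emeasure (\<kappa> \<omega>) {tau_eta \<eta> \<omega>..} \<partial>W)"
    using tau_eta_mem(1)[OF assms(1)]
    by (intro nn_integral_cong arg_cong[where f="emeasure _"]) (auto simp: space space_pair_measure intro: order.trans)
  also have "\<dots> = (\<integral>\<^sup>+\<omega>. 1 \<partial>W)" using AE by (rule nn_integral_cong_AE)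
  also have "\<dots> = 1" by (simp add: W.emeasure_space_1)
  finally have "\<xi>.prob ?S = 1" by (simp add: \<xi>.emeasure_eq_measure)
  then show ?thesis using S by (subst (asm) \<xi>.prob_eq_1) auto
qed

lemma emeasure_dirac_kernel:
  assumes "A \<in> sets Rplus_borel"
  shows "emeasure (dirac_kernel \<tau> \<omega>) A = (if \<tau> \<omega> < \<top> then indicator A (enn2real (\<tau> \<omega>)) else 0)"
  using assms by (simp add: dirac_kernel_def)

lemma measurable_enn2real_Rplus [measurable]: "enn2real \<in> borel \<rightarrow>\<^sub>M Rplus_borel"
  unfolding Rplus_borel_def by (rule measurable_restrict_space2) auto

lemma disintegrates_dirac_kernel:
  assumes W: "wiener_measure W" and \<tau>[measurable]: "\<tau> \<in> borel_measurable borel" and fin: "AE \<omega> in W. \<tau> \<omega> < \<top>"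
  shows "disintegrates W (distr W (borel \<Otimes>\<^sub>M Rplus_borel) (\<lambda>\<omega>. (\<omega>, enn2real (\<tau> \<omega>)))) (dirac_kernel \<tau>)"
  unfolding disintegrates_def
proof (intro conjI ballI)
  have [measurable_cong]: "sets W = sets borel" using W by (simp add: wiener_measure_def)
  show "sets (distr W (borel \<Otimes>\<^sub>M Rplus_borel) (\<lambda>\<omega>. (\<omega>, enn2real (\<tau> \<omega>)))) = sets (borel \<Otimes>\<^sub>M Rplus_borel)" by simp
  have null: "null_measure Rplus_borel \<in> space (subprob_algebra Rplus_borel)"
    by (auto simp: space_subprob_algebra intro!: subprob_spaceI)
  show "dirac_kernel \<tau> \<in> W \<rightarrow>\<^sub>M subprob_algebra Rplus_borel"
    unfolding dirac_kernel_def
    by (intro measurable_If measurable_compose[OF _ return_measurable] measurable_const null) measurable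
  fix A assume "A \<in> sets (distr W (borel \<Otimes>\<^sub>M Rplus_borel) (\<lambda>\<omega>. (\<omega>, enn2real (\<tau> \<omega>))))"
  then have A [measurable]: "A \<in> sets (borel \<Otimes>\<^sub>M Rplus_borel)" by simp
  have "emeasure (distr W (borel \<Otimes>\<^sub>M Rplus_borel) (\<lambda>\<omega>. (\<omega>, enn2real (\<tau> \<omega>)))) A =
    (\<integral>\<^sup>+p. indicator A p \<partial>distr W (borel \<Otimes>\<^sub>M Rplus_borel) (\<lambda>\<omega>. (\<omega>, enn2real (\<tau> \<omega>))))"
    by (rule nn_integral_indicator[symmetric]) simp
  also have "\<dots> = (\<integral>\<^sup>+\<omega>. indicator A (\<omega>, enn2real (\<tau> \<omega>)) \<partial>W)"
    by (rule nn_integral_distr) measurable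
  \<comment> \<open>Where \<open>\<tau>\<close> is infinite, \<open>enn2real\<close> yields time 0
    while the kernel has no mass; the two disagree only on a null set.\<close>
  also have "\<dots> = (\<integral>\<^sup>+\<omega>. emeasure (dirac_kernel \<tau> \<omega>) (Pair \<omega> -` A) \<partial>W)"
    using fin by (intro nn_integral_cong_AE, eventually_elim)
      (simp add: emeasure_dirac_kernel sets_Pair1[OF A] indicator_def)
  finally show "emeasure (distr W (borel \<Otimes>\<^sub>M Rplus_borel) (\<lambda>\<omega>. (\<omega>, enn2real (\<tau> \<omega>)))) A =
    (\<integral>\<^sup>+\<omega>. emeasure (dirac_kernel \<tau> \<omega>) (Pair \<omega> -` A) \<partial>W)" .
qed

theorem proposition3p9:
  fixes W :: "c0path measure" and \<nu> :: "real measure" and \<eta> :: real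
    and \<xi> :: "(c0path \<times> real) measure"
  assumes "wiener_measure W"
    and "prob_space \<nu>" and "sets \<nu> = sets borel"
    and "integrable \<nu> (\<lambda>x. x\<^sup>2)" and "(\<integral>x. x \<partial>\<nu>) = 0"
    and "\<eta> > 0"
    and "\<xi> \<in> RST_eta_embed W \<eta> \<nu>"
  shows "\<exists>\<xi>'. nonrandomized W \<xi>' \<and> \<xi>' \<in> RST_eta_embed W \<eta> \<nu> \<and>
           (\<forall>G\<in>Cb_eta \<eta>. (\<integral>p. G p \<partial>\<xi>') = (\<integral>p. G p \<partial>\<xi>))"
proof -
  note W = \<open>wiener_measure W\<close> and \<eta> = \<open>\<eta> > 0\<close>
  obtain \<kappa> where \<xi>: "prob_space \<xi>" and "rst_kernel W \<xi> \<kappa>"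
    and \<kappa>_post: "AE \<omega> in W. emeasure (\<kappa> \<omega>) {tau_eta \<eta> \<omega>..} = 1"
    and \<xi>_time: "(\<integral>\<^sup>+(\<omega>, t). ennreal t \<partial>\<xi>) < \<infinity>"
    and \<xi>_law: "distr \<xi> borel (\<lambda>(\<omega>, t). path_at \<omega> t) = \<nu>"
    using assms(7) by (auto simp: RST_eta_embed_def RST_eta_def RST_embed_def RST_def)
  then have dis: "disintegrates W \<xi> \<kappa>"
    and \<kappa>_raw: "\<And>t. 0 \<le> t \<Longrightarrow> (\<lambda>\<omega>. emeasure (\<kappa> \<omega>) {0..t}) \<in> borel_measurable (raw_filtration (ennreal t))"
    by (auto simp: rst_kernel_def)
  interpret W: prob_space W using W by (simp add: wiener_measure_def)
  interpret \<xi>: prob_space \<xi> by (rule \<xi>)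
  have sets_W [measurable_cong, simp]: "sets W = sets borel" using W by (simp add: wiener_measure_def)
  have space_W [simp]: "space W = UNIV" using sets_eq_imp_space_eq[OF sets_W] by simp
  have \<kappa>_meas: "\<kappa> \<in> W \<rightarrow>\<^sub>M subprob_algebra Rplus_borel" using dis by (simp add: disintegrates_def)
  have \<kappa>_sub: "subprob_space (\<kappa> \<omega>)" and \<kappa>_sets: "sets (\<kappa> \<omega>) = sets Rplus_borel" for \<omega>
    using measurable_space[OF \<kappa>_meas, of \<omega>] by (auto simp: space_subprob_algebra)
  have \<kappa>_le: "emeasure (\<kappa> \<omega>) (space (\<kappa> \<omega>)) \<le> 1" for \<omega>
    using subprob_space.emeasure_space_le_1[OF \<kappa>_sub] .
  have \<kappa>_borel: "(\<lambda>\<omega>. emeasure (\<kappa> \<omega>) {0..t}) \<in> borel_measurable borel" if "0 \<le> t" for t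
    by (rule measurable_raw_borel[OF \<kappa>_raw[OF that]])
  define \<tau> where "\<tau> = derandomized_time \<eta> \<kappa>"
  have \<tau>_le_iff: "\<tau> \<omega> \<le> ennreal t \<longleftrightarrow> stop_by \<eta> \<kappa> \<omega> t" if "0 \<le> t" for \<omega> t
    unfolding \<tau>_def by (rule derandomized_time_le_iff[OF \<eta> that \<kappa>_sets \<kappa>_le \<kappa>_borel])
  have \<tau>_raw: "Measurable.pred (raw_filtration t) (\<lambda>\<omega>. \<tau> \<omega> \<le> t)" for t
  proof (cases t)
    case (real r)
    then show ?thesis using pred_stop_by[where \<kappa>=\<kappa>, OF \<eta> _ \<kappa>_raw, of r] by (simp add: \<tau>_le_iff)
  qed simp
  have \<tau>_meas [measurable]: "\<tau> \<in> borel_measurable borel"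
  proof (rule borel_measurableI_le)
    show "{\<omega> \<in> space borel. \<tau> \<omega> \<le> t} \<in> sets borel" for t
      using measurable_raw_borel[OF \<tau>_raw[of t]] by (simp add: pred_def)
  qed
  let ?P = "(borel :: c0path measure) \<Otimes>\<^sub>M Rplus_borel" and ?Q = "post_algebra \<eta> \<Otimes>\<^sub>M Rplus_borel"
  define \<xi>' where "\<xi>' = distr W ?P (\<lambda>\<omega>. (\<omega>, enn2real (\<tau> \<omega>)))"
  have sets_\<xi> [measurable_cong]: "sets \<xi> = sets ?P" using dis by (simp add: disintegrates_def)
  have sets_\<xi>' [measurable_cong]: "sets \<xi>' = sets ?P" by (simp add: \<xi>'_def)
  have \<xi>': "prob_space \<xi>'" unfolding \<xi>'_def by (rule W.prob_space_distr) measurable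
  interpret \<xi>': prob_space \<xi>' by (rule \<xi>')
  \<comment> \<open>The identity map serves to restrict both joint laws to the coarser sigma-algebra
    of the path after the exit.\<close>
  have to_post: "(\<lambda>p. p) \<in> ?P \<rightarrow>\<^sub>M ?Q"
  proof -
    have "(\<lambda>\<omega>. \<omega>) \<in> borel \<rightarrow>\<^sub>M post_algebra \<eta>"
      by (rule measurableI) (auto simp: sets_post_algebra)
    from measurable_compose[OF measurable_fst this] show ?thesis
      by (simp add: measurable_split_conv measurable_pair_iff comp_def)
  qed
  have post_rect: "C \<times> {0..t} \<in> sets ?P" if "C \<in> sets (post_algebra \<eta>)" for C t
    using that by (intro pair_measureI) (auto simp: sets_post_algebra)
  have \<xi>_rect: "emeasure \<xi> (C \<times> {0..t}) = emeasure W {\<omega> \<in> C. \<tau> \<omega> \<le> ennreal t}"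
    if C: "C \<in> sets (post_algebra \<eta>)" and t: "0 \<le> t" for C t
  proof -
    have "emeasure \<xi> (C \<times> {0..t}) = (\<integral>\<^sup>+\<omega>. emeasure (\<kappa> \<omega>) (Pair \<omega> -` (C \<times> {0..t})) \<partial>W)"
      using dis post_rect[OF C] by (auto simp: disintegrates_def)
    also have "\<dots> = (\<integral>\<^sup>+\<omega>. indicator {\<omega> \<in> C. tau_eta \<eta> \<omega> \<le> t} \<omega> * emeasure (\<kappa> \<omega>) {0..t} \<partial>W)"
    proof (rule nn_integral_cong_AE)
      show "AE \<omega> in W. emeasure (\<kappa> \<omega>) (Pair \<omega> -` (C \<times> {0..t})) =
          indicator {\<omega> \<in> C. tau_eta \<eta> \<omega> \<le> t} \<omega> * emeasure (\<kappa> \<omega>) {0..t}"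
        using \<kappa>_post
      proof eventually_elim
        fix \<omega> assume post: "emeasure (\<kappa> \<omega>) {tau_eta \<eta> \<omega>..} = 1"
        \<comment> \<open>The kernel already has mass 1 from the exit on and total mass at most 1,
          so nothing is left before it.\<close>
        have "emeasure (\<kappa> \<omega>) {0..t} = 0" if "t < tau_eta \<eta> \<omega>"
        proof -
          \<comment> \<open>\<open>emeasure\<close> is 0 on sets that are not measurable, so the
            value 1 certifies measurability.\<close>
          have mem: "{tau_eta \<eta> \<omega>..} \<in> sets (\<kappa> \<omega>)"
            using post emeasure_notin_sets by fastforce
          have "emeasure (\<kappa> \<omega>) {0..t} + emeasure (\<kappa> \<omega>) {tau_eta \<eta> \<omega>..} =
            emeasure (\<kappa> \<omega>) ({0..t} \<union> {tau_eta \<eta> \<omega>..})"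
            using that mem by (intro plus_emeasure) (auto simp: \<kappa>_sets)
          also have "\<dots> \<le> 1" using emeasure_space \<kappa>_le by (rule order.trans)
          finally have "1 + emeasure (\<kappa> \<omega>) {0..t} \<le> 1 + 0" using post by (simp add: add.commute)
          then have "emeasure (\<kappa> \<omega>) {0..t} \<le> 0" unfolding ennreal_add_left_cancel_le by simp
          then show ?thesis by simp
        qed
        moreover have "Pair \<omega> -` (C \<times> {0..t}) = (if \<omega> \<in> C then {0..t} else {})" by auto
        ultimately show "emeasure (\<kappa> \<omega>) (Pair \<omega> -` (C \<times> {0..t})) =
          indicator {\<omega> \<in> C. tau_eta \<eta> \<omega> \<le> t} \<omega> * emeasure (\<kappa> \<omega>) {0..t}"
          by (auto simp: indicator_def)
      qed
    qed
    also have "\<dots> = emeasure W {\<omega> \<in> C. \<tau> \<omega> \<le> ennreal t}"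
      using emeasure_stop_by[where \<kappa>=\<kappa>, OF W \<eta> t C \<kappa>_le \<kappa>_raw[OF t]] t by (simp add: \<tau>_le_iff)
    finally show ?thesis .
  qed
  \<comment> \<open>All mass of \<open>\<xi>\<close> sits at finite times, and
    \<open>\<xi>_rect\<close> passes this on to \<open>\<tau>\<close> by exhausting time with the
    intervals \<open>[0,n]\<close>.\<close>
  have \<tau>_fin: "AE \<omega> in W. \<tau> \<omega> < \<top>"
  proof -
    have U: "UNIV \<in> sets (post_algebra \<eta>)" using sets.top[of "post_algebra \<eta>"] by simp
    have "space \<xi> = (\<Union>n. UNIV \<times> {0..real n})"
      using sets_eq_imp_space_eq[OF sets_\<xi>] real_arch_simple by (auto simp: space_pair_measure)
    then have "1 = emeasure \<xi> (\<Union>n. UNIV \<times> {0..real n})" using \<xi>.emeasure_space_1 by simp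
    also have "\<dots> = (SUP n. emeasure \<xi> (UNIV \<times> {0..real n}))"
      using post_rect[OF U] by (intro SUP_emeasure_incseq[symmetric]) (auto simp: incseq_def sets_\<xi>)
    also have "\<dots> \<le> emeasure W {\<omega>. \<tau> \<omega> < \<top>}"
    proof (rule SUP_least)
      fix n
      have "emeasure \<xi> (UNIV \<times> {0..real n}) = emeasure W {\<omega> \<in> UNIV. \<tau> \<omega> \<le> ennreal (real n)}"
        by (rule \<xi>_rect[OF U]) simp
      also have "\<dots> \<le> emeasure W {\<omega>. \<tau> \<omega> < \<top>}"
      proof (rule emeasure_mono)
        have "{\<omega> \<in> space borel. \<tau> \<omega> < \<top>} \<in> sets borel" by measurable
        then show "{\<omega>. \<tau> \<omega> < \<top>} \<in> sets W" by simp
      qed (auto intro: le_less_trans)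
      finally show "emeasure \<xi> (UNIV \<times> {0..real n}) \<le> emeasure W {\<omega>. \<tau> \<omega> < \<top>}" .
    qed
    finally have "W.prob {\<omega> \<in> space W. \<tau> \<omega> < \<top>} = 1"
      using W.prob_le_1 by (simp add: W.emeasure_eq_measure antisym)
    then show ?thesis by (subst (asm) W.prob_Collect_eq_1) auto
  qed
  \<comment> \<open>The finite mean, the embedded law and the values on \<open>Cb_eta\<close> are
    all functionals of this restricted law, so each of them carries over from
    \<open>\<xi>\<close>.\<close>
  have law: "distr \<xi>' ?Q (\<lambda>p. p) = distr \<xi> ?Q (\<lambda>p. p)"
  proof (rule measure_eqI_post_Rplus)
    note [measurable] = to_post
    show "finite_measure (distr \<xi>' ?Q (\<lambda>p. p))"
      by (rule \<xi>'.finite_measure_distr) measurable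
    fix C and t :: real assume C: "C \<in> sets (post_algebra \<eta>)" and t: "0 \<le> t"
    have space: "space \<xi> = UNIV \<times> {0..}" "space \<xi>' = UNIV \<times> {0..}"
      using sets_eq_imp_space_eq[OF sets_\<xi>] sets_eq_imp_space_eq[OF sets_\<xi>'] by (auto simp: space_pair_measure)
    have Q: "C \<times> {0..t} \<in> sets ?Q" using C by (intro pair_measureI) auto
    have C_borel [measurable]: "C \<in> sets borel" using C by (simp add: sets_post_algebra)
    have "emeasure (distr \<xi>' ?Q (\<lambda>p. p)) (C \<times> {0..t}) = emeasure \<xi>' (C \<times> {0..t})"
      using Q by (subst emeasure_distr) (auto simp: space intro!: arg_cong[where f="emeasure _"])
    also have "\<dots> = emeasure W ((\<lambda>\<omega>. (\<omega>, enn2real (\<tau> \<omega>))) -` (C \<times> {0..t}))"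
      unfolding \<xi>'_def using post_rect[OF C] by (subst emeasure_distr) auto
    also have "\<dots> = emeasure W {\<omega> \<in> C. \<tau> \<omega> \<le> ennreal t}"
    proof (rule emeasure_eq_AE)
      show "AE \<omega> in W. \<omega> \<in> (\<lambda>\<omega>. (\<omega>, enn2real (\<tau> \<omega>))) -` (C \<times> {0..t}) \<longleftrightarrow> \<omega> \<in> {\<omega> \<in> C. \<tau> \<omega> \<le> ennreal t}"
        using \<tau>_fin
      proof eventually_elim
        fix \<omega> assume "\<tau> \<omega> < \<top>"
        then have "\<tau> \<omega> = ennreal (enn2real (\<tau> \<omega>))" by simp
        then have "\<tau> \<omega> \<le> ennreal t \<longleftrightarrow> enn2real (\<tau> \<omega>) \<le> t" using t by (metis ennreal_le_iff)
        then show "\<omega> \<in> (\<lambda>\<omega>. (\<omega>, enn2real (\<tau> \<omega>))) -` (C \<times> {0..t}) \<longleftrightarrow> \<omega> \<in> {\<omega> \<in> C. \<tau> \<omega> \<le> ennreal t}"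
          by auto
      qed
      have "(\<lambda>\<omega>. (\<omega>, enn2real (\<tau> \<omega>))) -` (C \<times> {0..t}) \<inter> space borel \<in> sets borel"
        by (rule measurable_sets[OF _ post_rect[OF C]]) measurable
      then show "(\<lambda>\<omega>. (\<omega>, enn2real (\<tau> \<omega>))) -` (C \<times> {0..t}) \<in> sets W" by simp
      have "{\<omega> \<in> space borel. \<omega> \<in> C \<and> \<tau> \<omega> \<le> ennreal t} \<in> sets borel" by measurable
      then show "{\<omega> \<in> C. \<tau> \<omega> \<le> ennreal t} \<in> sets W" by simp
    qed
    also have "\<dots> = emeasure \<xi> (C \<times> {0..t})" by (rule \<xi>_rect[OF C t, symmetric])
    also have "\<dots> = emeasure (distr \<xi> ?Q (\<lambda>p. p)) (C \<times> {0..t})"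
      using Q by (subst emeasure_distr) (auto simp: space intro!: arg_cong[where f="emeasure _"])
    finally show "emeasure (distr \<xi>' ?Q (\<lambda>p. p)) (C \<times> {0..t}) = \<dots>" .
  qed simp_all
  have ident: "(\<lambda>p. p) \<in> \<xi> \<rightarrow>\<^sub>M ?Q" "(\<lambda>p. p) \<in> \<xi>' \<rightarrow>\<^sub>M ?Q"
    using to_post by (auto cong: measurable_cong_sets simp: measurable_cong_sets[OF sets_\<xi> refl] measurable_cong_sets[OF sets_\<xi>' refl])
  have dis': "disintegrates W \<xi>' (dirac_kernel \<tau>)"
    unfolding \<xi>'_def by (rule disintegrates_dirac_kernel[OF W \<tau>_meas \<tau>_fin])
  have kernel': "rst_kernel W \<xi>' (dirac_kernel \<tau>)"
    unfolding rst_kernel_def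
  proof (intro conjI allI impI dis')
    have R: "{0..} \<in> sets Rplus_borel" using sets.top[of Rplus_borel] by simp
    show "AE \<omega> in W. emeasure (dirac_kernel \<tau> \<omega>) {0..} = 1"
      using \<tau>_fin by eventually_elim (simp add: emeasure_dirac_kernel R)
    fix t :: real assume t: "0 \<le> t"
    \<comment> \<open>Holds at every path, as both sides are 0 where \<open>\<tau>\<close> is
      infinite; raw measurability would not survive a change on a null set.\<close>
    have "emeasure (dirac_kernel \<tau> \<omega>) {0..t} = indicator {\<omega>. \<tau> \<omega> \<le> ennreal t} \<omega>" for \<omega>
      using t by (cases "\<tau> \<omega>") (auto simp: emeasure_dirac_kernel indicator_def top_unique)
    moreover have "{\<omega>. \<tau> \<omega> \<le> ennreal t} \<in> sets (raw_filtration (ennreal t))"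
      using \<tau>_raw[of "ennreal t"] by (simp add: pred_def)
    ultimately show "(\<lambda>\<omega>. emeasure (dirac_kernel \<tau> \<omega>) {0..t}) \<in> borel_measurable (raw_filtration (ennreal t))"
      by simp
  qed
  have post': "AE \<omega> in W. emeasure (dirac_kernel \<tau> \<omega>) {tau_eta \<eta> \<omega>..} = 1"
    using \<tau>_fin
  proof eventually_elim
    fix \<omega> assume fin: "\<tau> \<omega> < \<top>"
    have "{tau_eta \<eta> \<omega>..} \<in> sets Rplus_borel"
      using tau_eta_mem(1)[OF \<eta>, of \<omega>]
      by (auto simp: Rplus_borel_def sets_restrict_space image_iff intro!: bexI[of _ "{tau_eta \<eta> \<omega>..}"])
    moreover have "tau_eta \<eta> \<omega> \<le> enn2real (\<tau> \<omega>)"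
      using tau_eta_le_derandomized_time[OF \<eta>, of \<omega> \<kappa>] fin tau_eta_mem(1)[OF \<eta>, of \<omega>]
      unfolding \<tau>_def by (cases "derandomized_time \<eta> \<kappa> \<omega>") (auto simp: ennreal_le_iff2)
    ultimately show "emeasure (dirac_kernel \<tau> \<omega>) {tau_eta \<eta> \<omega>..} = 1"
      using fin by (simp add: emeasure_dirac_kernel)
  qed
  have RST': "\<xi>' \<in> RST W" using \<xi>' kernel' by (auto simp: RST_def)
  have "\<tau> \<in> finite_stopping_times W"
    using \<tau>_fin \<tau>_raw by (simp add: finite_stopping_times_def stopping_time_def)
  with RST' dis' have "nonrandomized W \<xi>'" by (auto simp: nonrandomized_def)
  moreover have "\<xi>' \<in> RST_eta W \<eta>" using RST' kernel' post' by (auto simp: RST_eta_def)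
  moreover have "\<xi>' \<in> RST_embed W \<nu>"
  proof -
    have snd_meas: "(\<lambda>(\<omega>, t). ennreal t) \<in> borel_measurable ?Q"
      unfolding case_prod_beta
      by (intro measurable_compose[OF measurable_snd] measurable_compose[OF _ measurable_ennreal])
         (simp add: Rplus_borel_def measurable_restrict_space1)
    have "(\<integral>\<^sup>+(\<omega>, t). ennreal t \<partial>\<xi>') = (\<integral>\<^sup>+(\<omega>, t). ennreal t \<partial>distr \<xi>' ?Q (\<lambda>p. p))"
      using snd_meas by (subst nn_integral_distr[OF ident(2)]) simp_all
    also have "\<dots> = (\<integral>\<^sup>+(\<omega>, t). ennreal t \<partial>\<xi>)"
      unfolding law using snd_meas by (subst nn_integral_distr[OF ident(1)]) simp_all
    finally have time: "(\<integral>\<^sup>+(\<omega>, t). ennreal t \<partial>\<xi>') < \<infinity>" using \<xi>_time by simp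
    let ?B = "\<lambda>(\<omega>, t). path_at \<omega> t" and ?b = "\<lambda>(\<omega>, t). if tau_eta \<eta> \<omega> \<le> t then path_at \<omega> t else 0"
    note b = measurable_path_after_tau[OF \<eta>]
    note [measurable] = measurable_path_at_pair measurable_compose[OF to_post b]
    \<comment> \<open>Stopping occurs after the exit almost surely, so the cut-off process, which is
      measurable for the coarser sigma-algebra, has the law of the stopped position.\<close>
    have B: "distr \<zeta> borel ?B = distr (distr \<zeta> ?Q (\<lambda>p. p)) borel ?b"
      if [measurable_cong]: "sets \<zeta> = sets ?P" and AE: "AE p in \<zeta>. tau_eta \<eta> (fst p) \<le> snd p" for \<zeta>
    proof -
      have "distr \<zeta> borel ?B = distr \<zeta> borel ?b"
        using AE by (intro distr_cong_AE) (auto elim: eventually_mono)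
      also have "\<dots> = distr (distr \<zeta> ?Q (\<lambda>p. p)) borel ?b"
        using to_post b by (subst distr_distr) (auto simp: comp_def cong: measurable_cong_sets)
      finally show ?thesis .
    qed
    have "distr \<xi>' borel ?B = distr \<xi> borel ?B"
      using B[OF sets_\<xi> AE_tau_eta_le[OF \<eta> dis \<xi> W \<kappa>_post]]
        B[OF sets_\<xi>' AE_tau_eta_le[OF \<eta> dis' \<xi>' W post']] law by simp
    with \<xi>_law time RST' show ?thesis by (simp add: RST_embed_def)
  qed
  moreover have "(\<integral>p. G p \<partial>\<xi>') = (\<integral>p. G p \<partial>\<xi>)" if "G \<in> Cb_eta \<eta>" for G
  proof -
    note G = measurable_Cb_eta[OF that]
    have "(\<integral>p. G p \<partial>\<xi>') = (\<integral>p. G p \<partial>distr \<xi>' ?Q (\<lambda>p. p))"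
      by (rule integral_distr[OF ident(2) G, symmetric])
    also have "\<dots> = (\<integral>p. G p \<partial>\<xi>)"
      unfolding law by (rule integral_distr[OF ident(1) G])
    finally show ?thesis .
  qed
  ultimately show ?thesis unfolding RST_eta_embed_def by blast
qed

end
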